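(* There exists a constant $\delta>0$ such that for each integer $m\ge2$, \[\mathrm{BH}^{\mathrm{mult}}_{\ell_{\frac{2m}{m+1},\frac{2(m-1)}{m}}}(m)\le m^{\delta}.\]
   Context: For a finite index set $I$, $1\le p<\infty$, $1\le q<\infty$, the Lorentz (quasi)norm is $\|x\|_{\ell_{p,q}(I)}=\big(\sum_{k}(x_k^* )^q(k^{q/p}-(k-1)^{q/p})\big)^{1/q}$, where $x^*$ is the non-increasing rearrangement of $(|x_i|)_{i\in I}$. Let $\mathcal M(m,n)=\{(i_1,\dots,i_m):1\le i_k\le n\}$. For a complex matrix $a=(a_{\mathbf i})_{\mathbf i\in\mathcal M(m,n)}$, $\|a\|_\infty=\sup\big|\sum_{\mathbf i}a_{\mathbf i}x^1_{i_1}\cdots x^m_{i_m}\big|$ over $x^k\in\mathbb C^n$ with $\sup$-norm $\le1$. For a sequence space $X$ (such as $\ell_{p,q}$, defined on any index set), $\mathrm{BH}^{\mathrm{mult}}_X(m)$ denotes the best constant $C\ge1$ such that $\|(a_{\mathbf i})_{\mathbf i\in\mathcal M(m,n)}\|_{X}\le C\|a\|_\infty$ for every $n$ and every complex matrix $a$ on $\mathcal M(m,n)$. *)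

theory Defs
  imports "HOL-Analysis.Analysis" "HOL-Library.Multiset" "HOL-Library.Extended_Real"
begin

text \<open>Non-increasing rearrangement of (|x_i|)_{i in I}, as a list of length card I
  (entry k-1 is x*_k).\<close>
definition decr_rearr :: "'i set \<Rightarrow> ('i \<Rightarrow> complex) \<Rightarrow> real list" where
  "decr_rearr I x = rev (sorted_list_of_multiset (image_mset (\<lambda>i. cmod (x i)) (mset_set I)))"

definition lorentz_norm :: "real \<Rightarrow> real \<Rightarrow> 'i set \<Rightarrow> ('i \<Rightarrow> complex) \<Rightarrow> real" where
  "lorentz_norm p q I x =
     (\<Sum>k=1..card I. (decr_rearr I x ! (k - 1)) powr q
        * (real k powr (q / p) - real (k - 1) powr (q / p))) powr (1 / q)"

definition multi_idx :: "nat \<Rightarrow> nat \<Rightarrow> nat list set" where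
  "multi_idx m n = {i. length i = m \<and> set i \<subseteq> {1..n}}"

text \<open>The sup norm of the m-linear form with coefficient matrix a on M(m,n).
  x k i is the i-th coordinate of x^(k+1).\<close>
definition mult_sup_norm :: "nat \<Rightarrow> nat \<Rightarrow> (nat list \<Rightarrow> complex) \<Rightarrow> real" where
  "mult_sup_norm m n a =
     Sup {cmod (\<Sum>i\<in>multi_idx m n. a i * (\<Prod>k<m. x k (i ! k))) | x :: nat \<Rightarrow> nat \<Rightarrow> complex.
            \<forall>k<m. \<forall>j\<in>{1..n}. cmod (x k j) \<le> 1}"

text \<open>Best constant C >= 1 (in the extended reals; infinity if no such constant).\<close>
definition BH_mult_lorentz :: "real \<Rightarrow> real \<Rightarrow> nat \<Rightarrow> ereal" where
  "BH_mult_lorentz p q m =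
     Inf {ereal C | C. C \<ge> 1 \<and> (\<forall>n (a :: nat list \<Rightarrow> complex).
            lorentz_norm p q (multi_idx m n) a \<le> C * mult_sup_norm m n a)}"

end

theory Submission
  imports Defs
begin

text \<open>Put \<open>p = 2 m / (m + 1)\<close> and \<open>q = 2 (m - 1) / m\<close>, so that \<open>q / p = 1 - 1 / m\<^sup>2\<close>. Averaging the
  Bohnenblust--Hille inequality for \<open>(m - 1)\<close>-linear forms over random signs in the \<open>j\<close>-th variable
  bounds, by Khinchine's inequality, the mixed norm that is \<open>\<ell>\<^sub>2\<close> in the \<open>j\<close>-th index and
  \<open>\<ell>\<^sub>q\<close> in the others, at the cost of a factor \<open>3\<^bsup>1/m\<^esup>\<close>. Blei's inequality turns
  these \<open>m\<close> mixed norms into the \<open>\<ell>\<^sub>p\<close> norm without loss, so the multilinear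
  Bohnenblust--Hille constants are at most \<open>m\<^sup>2\<close>.

  For the Lorentz norm only the last step changes. Rank the entries by modulus and give the entry of
  rank \<open>r\<close> the weight \<open>r\<^bsup>-1/m\<^esup>\<close>. An entry is light in direction \<open>j\<close> if the entries of rank
  at most its own on its fibre in that direction have total weight at most 4. By the Loomis--Whitney
  inequality at most half of the entries of rank at most \<open>k\<close> are light in no direction, for every
  \<open>k\<close>; as the sum defining the Lorentz norm has terms that decrease with the rank, these entries
  carry at most half of it. On the entries that are light in direction \<open>j\<close>, Hoelder's inequality
  along the fibres gives the \<open>j\<close>-th mixed norm.\<close>

section \<open>The inequalities of Finner, Loomis--Whitney and Blei\<close>

lemma sum_PiE_insert:
  fixes g :: "('a \<Rightarrow> 'b) \<Rightarrow> 'c::comm_monoid_add"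
  assumes "finite J" "finite X" "v \<notin> J"
  shows "sum g (insert v J \<rightarrow>\<^sub>E X) = (\<Sum>y\<in>J \<rightarrow>\<^sub>E X. \<Sum>t\<in>X. g (y(v := t)))"
proof -
  have inj: "inj_on (\<lambda>(t, y). y(v := t)) (X \<times> (J \<rightarrow>\<^sub>E X))"
    using assms(3) by (rule inj_combinator)
  have "sum g (insert v J \<rightarrow>\<^sub>E X) = (\<Sum>(t, y)\<in>X \<times> (J \<rightarrow>\<^sub>E X). g (y(v := t)))"
    unfolding PiE_insert_eq by (subst sum.reindex[OF inj]) (simp add: case_prod_unfold)
  also have "\<dots> = (\<Sum>t\<in>X. \<Sum>y\<in>J \<rightarrow>\<^sub>E X. g (y(v := t)))"
    by (rule sum.cartesian_product [symmetric])
  also have "\<dots> = (\<Sum>y\<in>J \<rightarrow>\<^sub>E X. \<Sum>t\<in>X. g (y(v := t)))"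
    by (rule sum.swap)
  finally show ?thesis .
qed

lemma sum_PiE_split:
  fixes g :: "('a \<Rightarrow> 'b) \<Rightarrow> 'c::comm_monoid_add"
  assumes "finite J" "finite X" "v \<in> J"
  shows "sum g (J \<rightarrow>\<^sub>E X) = (\<Sum>y\<in>(J - {v}) \<rightarrow>\<^sub>E X. \<Sum>t\<in>X. g (y(v := t)))"
  using sum_PiE_insert[of "J - {v}" X v g] assms by (simp add: insert_absorb)

lemma restrict_fun_upd_same [simp]:
  assumes "y \<in> (J - {v}) \<rightarrow>\<^sub>E X"
  shows "restrict (y(v := t)) (J - {v}) = y"
  using assms by (auto simp: PiE_def extensional_def restrict_def fun_eq_iff)

text \<open>Once each \<open>g k\<close> is divided by its sum \<open>G k\<close>, this is the
  arithmetic-geometric mean inequality at each \<open>t\<close>, summed over \<open>t\<close>. If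
  some \<open>G k\<close> is 0, the left side vanishes.\<close>

lemma Hoelder_sum_prod:
  fixes g :: "'k \<Rightarrow> 't \<Rightarrow> real"
  assumes K: "finite K" "card K = N" "N \<ge> 1"
    and g: "\<And>k t. k \<in> K \<Longrightarrow> t \<in> X \<Longrightarrow> g k t \<ge> 0"
  shows "(\<Sum>t\<in>X. (\<Prod>k\<in>K. g k t) powr (1 / N)) \<le> (\<Prod>k\<in>K. \<Sum>t\<in>X. g k t) powr (1 / N)"
proof (cases "finite X")
  case False then show ?thesis by simp
next
  case X: True
  define G where "G k = (\<Sum>t\<in>X. g k t)" for k
  have K0: "K \<noteq> {}" using K by auto
  have G0: "G k \<ge> 0" if "k \<in> K" for k unfolding G_def using g that by (auto intro: sum_nonneg)
  show ?thesis
  proof (cases "\<exists>k\<in>K. G k = 0")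
    case True
    then obtain k where k: "k \<in> K" "G k = 0" by blast
    then have "g k t = 0" if "t \<in> X" for t
      using g that X unfolding G_def by (simp add: sum_nonneg_eq_0_iff)
    then have "(\<Prod>k\<in>K. g k t) = 0" if "t \<in> X" for t
      using that k K by (metis prod_zero_iff)
    then show ?thesis by simp
  next
    case False
    then have Gpos: "G k > 0" if "k \<in> K" for k using G0 that by (metis less_eq_real_def)
    have PG: "(\<Prod>k\<in>K. G k) > 0" by (intro prod_pos) (use Gpos in auto)
    have "(\<Sum>t\<in>X. (\<Prod>k\<in>K. g k t) powr (1 / N))
        = (\<Sum>t\<in>X. (\<Prod>k\<in>K. g k t / G k) powr (1 / N) * (\<Prod>k\<in>K. G k) powr (1 / N))"
      using PG g by (intro sum.cong refl) (simp add: prod_dividef powr_mult [symmetric])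
    also have "\<dots> \<le> (\<Sum>t\<in>X. (\<Sum>k\<in>K. g k t / G k / N) * (\<Prod>k\<in>K. G k) powr (1 / N))"
    proof (intro sum_mono mult_right_mono)
      fix t assume "t \<in> X"
      then show "(\<Prod>k\<in>K. g k t / G k) powr (1 / N) \<le> (\<Sum>k\<in>K. g k t / G k / N)"
        using arith_geom_mean[OF K(1) K0, of "\<lambda>k. g k t / G k"] K g G0 by simp
    qed simp
    also have "\<dots> = (\<Sum>k\<in>K. (\<Sum>t\<in>X. g k t) / G k / N) * (\<Prod>k\<in>K. G k) powr (1 / N)"
      unfolding sum_distrib_right [symmetric] sum.swap[of _ X K] sum_divide_distrib ..
    also have "(\<Sum>k\<in>K. (\<Sum>t\<in>X. g k t) / G k / N) = (\<Sum>k\<in>K. 1 / N)"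
      using Gpos by (intro sum.cong refl) (simp add: G_def [symmetric] less_imp_neq [THEN not_sym])
    also have "\<dots> = 1" using K by simp
    finally show ?thesis by (simp add: G_def)
  qed
qed

text \<open>Induction on the coordinates. With coordinate \<open>v\<close> frozen at
  \<open>t\<close>, the induction hypothesis bounds the sum over the others; the sum over
  \<open>t\<close> is then Hoelder's inequality for \<open>N\<close> functions, because
  \<open>v\<close> lies in exactly \<open>N\<close> of the sets \<open>S k\<close>.\<close>

theorem Finner_inequality:
  fixes f :: "'k \<Rightarrow> ('a \<Rightarrow> 'b) \<Rightarrow> real"
  assumes "finite J" and X: "finite X" and K: "finite K" and N: "N \<ge> 1"
    and "\<And>k. k \<in> K \<Longrightarrow> S k \<subseteq> J"
    and "\<And>v. v \<in> J \<Longrightarrow> card {k \<in> K. v \<in> S k} = N"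
    and "\<And>k y. k \<in> K \<Longrightarrow> f k y \<ge> 0"
  shows "(\<Sum>i\<in>J \<rightarrow>\<^sub>E X. (\<Prod>k\<in>K. f k (restrict i (S k))) powr (1 / N))
    \<le> (\<Prod>k\<in>K. \<Sum>y\<in>S k \<rightarrow>\<^sub>E X. f k y) powr (1 / N)"
  using assms(1,5,6,7)
proof (induction J arbitrary: S f)
  case empty
  then have "S k = {}" if "k \<in> K" for k using that by blast
  then have "(\<Prod>k\<in>K. \<Sum>y\<in>S k \<rightarrow>\<^sub>E X. f k y) = (\<Prod>k\<in>K. f k (\<lambda>x. undefined))"
    "(\<Prod>k\<in>K. f k (restrict (\<lambda>x. undefined) (S k))) = (\<Prod>k\<in>K. f k (\<lambda>x. undefined))"
    by (auto intro!: prod.cong)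
  then show ?case by simp
next
  case (insert v J)
  define K1 where "K1 = {k \<in> K. v \<in> S k}"
  define S' where "S' k = S k - {v}" for k
  \<comment> \<open>\<open>h t k\<close> is \<open>f k\<close> with coordinate \<open>v\<close>
    frozen at \<open>t\<close>; a factor whose set omits \<open>v\<close> stays as it is.\<close>
  define h where "h t k y = (if v \<in> S k then f k (y(v := t)) else f k y)" for t k y
  define G where "G k t = (\<Sum>y\<in>S' k \<rightarrow>\<^sub>E X. h t k y)" for k t
  have K1: "K1 \<subseteq> K" "finite K1" "card K1 = N" "finite (K - K1)"
    using K insert.prems(2)[of v] by (auto simp: K1_def)
  have finS: "finite (S k)" if "k \<in> K" for k
    using insert.prems(1)[OF that] insert.hyps(1) by (meson finite_insert finite_subset)
  have h0: "h t k y \<ge> 0" if "k \<in> K" for t k y using insert.prems(3)[OF that] by (simp add: h_def)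
  then have G0: "G k t \<ge> 0" if "k \<in> K" for k t using that by (auto simp: G_def intro!: sum_nonneg)
  have restr: "f k (restrict (i(v := t)) (S k)) = h t k (restrict i (S' k))"
    if "k \<in> K" for k i t
  proof -
    have "restrict (i(v := t)) (S k) = (restrict i (S' k))(v := t)" if "v \<in> S k"
      using that by (auto simp: S'_def restrict_def fun_eq_iff)
    moreover have "restrict (i(v := t)) (S k) = restrict i (S' k)" if "v \<notin> S k"
      using that by (auto simp: S'_def restrict_def fun_eq_iff)
    ultimately show ?thesis by (simp add: h_def)
  qed
  have IH: "(\<Sum>i\<in>J \<rightarrow>\<^sub>E X. (\<Prod>k\<in>K. h t k (restrict i (S' k))) powr (1 / N))
      \<le> (\<Prod>k\<in>K. G k t) powr (1 / N)" for t
    unfolding G_def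
  proof (rule insert.IH)
    show "S' k \<subseteq> J" if "k \<in> K" for k using insert.prems(1)[OF that] by (auto simp: S'_def)
    show "card {k \<in> K. w \<in> S' k} = N" if "w \<in> J" for w
    proof -
      have "{k \<in> K. w \<in> S' k} = {k \<in> K. w \<in> S k}"
        using that insert.hyps by (auto simp: S'_def)
      then show ?thesis using insert.prems(2)[of w] that by simp
    qed
  qed (use h0 in auto)
  have G_out: "(\<Sum>y\<in>S k \<rightarrow>\<^sub>E X. f k y) = G k t" if "k \<in> K - K1" for k t
    using that by (auto simp: G_def h_def K1_def S'_def)
  have G_in: "(\<Sum>y\<in>S k \<rightarrow>\<^sub>E X. f k y) = (\<Sum>t\<in>X. G k t)" if "k \<in> K1" for k
  proof -
    have "(\<Sum>y\<in>S k \<rightarrow>\<^sub>E X. f k y) = (\<Sum>y\<in>S' k \<rightarrow>\<^sub>E X. \<Sum>t\<in>X. f k (y(v := t)))"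
      using that finS[of k] X by (simp add: S'_def K1_def sum_PiE_split)
    also have "\<dots> = (\<Sum>t\<in>X. G k t)"
      using that by (subst sum.swap) (simp add: G_def h_def K1_def)
    finally show ?thesis .
  qed
  \<comment> \<open>The factors outside \<open>K1\<close> do not depend on \<open>t\<close>, so
    \<open>c\<close> leaves the sum over \<open>t\<close>.\<close>
  define c where "c = (\<Prod>k\<in>K - K1. \<Sum>y\<in>S k \<rightarrow>\<^sub>E X. f k y) powr (1 / N)"
  have "(\<Sum>i\<in>insert v J \<rightarrow>\<^sub>E X. (\<Prod>k\<in>K. f k (restrict i (S k))) powr (1 / N))
      = (\<Sum>t\<in>X. \<Sum>i\<in>J \<rightarrow>\<^sub>E X. (\<Prod>k\<in>K. h t k (restrict i (S' k))) powr (1 / N))"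
    using insert.hyps X by (subst sum.swap) (simp add: sum_PiE_insert restr cong: prod.cong)
  also have "\<dots> \<le> (\<Sum>t\<in>X. (\<Prod>k\<in>K. G k t) powr (1 / N))"
    by (intro sum_mono IH)
  also have "\<dots> = (\<Sum>t\<in>X. c * (\<Prod>k\<in>K1. G k t) powr (1 / N))"
  proof (intro sum.cong refl)
    fix t
    have "(\<Prod>k\<in>K. G k t) = (\<Prod>k\<in>K - K1. G k t) * (\<Prod>k\<in>K1. G k t)"
      using K K1 by (simp add: prod.subset_diff)
    moreover have "(\<Prod>k\<in>K - K1. G k t) = (\<Prod>k\<in>K - K1. \<Sum>y\<in>S k \<rightarrow>\<^sub>E X. f k y)"
      by (intro prod.cong refl) (simp add: G_out[of _ t])
    ultimately show "(\<Prod>k\<in>K. G k t) powr (1 / N) = c * (\<Prod>k\<in>K1. G k t) powr (1 / N)"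
      using G0 K1 insert.prems(3) 
      by (simp add: c_def powr_mult prod_nonneg sum_nonneg subset_iff)
  qed
  also have "\<dots> \<le> c * (\<Prod>k\<in>K1. \<Sum>t\<in>X. G k t) powr (1 / N)"
    unfolding sum_distrib_left [symmetric]
    using K1 N G0 by (intro mult_left_mono Hoelder_sum_prod) (auto simp: c_def)
  also have "\<dots> = c * (\<Prod>k\<in>K1. \<Sum>y\<in>S k \<rightarrow>\<^sub>E X. f k y) powr (1 / N)"
    using G_in by (simp cong: prod.cong)
  also have "\<dots> = (\<Prod>k\<in>K. \<Sum>y\<in>S k \<rightarrow>\<^sub>E X. f k y) powr (1 / N)"
    using K K1 insert.prems(3) unfolding c_def
    by (subst powr_mult [symmetric]) (auto intro!: prod_nonneg sum_nonneg simp: prod.subset_diff)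
  finally show ?case .
qed

text \<open>Finner's inequality for the sets \<open>J - {j}\<close>: a coordinate is missed only by
  its own set, hence covered \<open>m - 1\<close> times.\<close>

corollary Loomis_Whitney:
  fixes f :: "'a \<Rightarrow> ('a \<Rightarrow> 'b) \<Rightarrow> real"
  assumes J: "finite J" "card J = m" "m \<ge> 2" and X: "finite X"
    and f: "\<And>j y. j \<in> J \<Longrightarrow> f j y \<ge> 0"
  shows "(\<Sum>i\<in>J \<rightarrow>\<^sub>E X. (\<Prod>j\<in>J. f j (restrict i (J - {j}))) powr (1 / (real m - 1)))
    \<le> (\<Prod>j\<in>J. \<Sum>y\<in>(J - {j}) \<rightarrow>\<^sub>E X. f j y) powr (1 / (real m - 1))"
proof -
  have "{j \<in> J. v \<in> J - {j}} = J - {v}" if "v \<in> J" for v using that by auto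
  then have "card {j \<in> J. v \<in> J - {j}} = m - 1" if "v \<in> J" for v
    using that J by simp
  then show ?thesis
    using Finner_inequality[of J X J "m - 1" "\<lambda>j. J - {j}" f] assms
    by (auto simp: of_nat_diff)
qed

text \<open>With \<open>H j y\<close> the square sum over a fibre, the \<open>m\<close> numbers
  \<open>(b i)\<^sup>2 * H j (R j i) powr (- 1 / m)\<close> and the product of all
  \<open>H j (R j i) powr (1 / m)\<close> multiply to \<open>b i powr (2 * m)\<close>. Hence the
  mean of these \<open>m + 1\<close> numbers dominates \<open>b i powr (2 * m / (m + 1))\<close>.
  Summed over \<open>i\<close>, each of the first \<open>m\<close> becomes a mixed norm, and the
  last is controlled by Loomis--Whitney.\<close>

lemma Blei_normalized:
  fixes b :: "('a \<Rightarrow> 'b) \<Rightarrow> real"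
  assumes J: "finite J" "card J = m" "m \<ge> 2" and X: "finite X"
    and b: "\<And>i. b i \<ge> 0"
    and mixed: "\<And>j. j \<in> J \<Longrightarrow>
      (\<Sum>y\<in>(J - {j}) \<rightarrow>\<^sub>E X. (\<Sum>t\<in>X. (b (y(j := t)))\<^sup>2) powr ((real m - 1) / m)) \<le> 1"
  shows "(\<Sum>i\<in>J \<rightarrow>\<^sub>E X. b i powr (2 * real m / (real m + 1))) \<le> 1"
proof -
  define H where "H j y = (\<Sum>t\<in>X. (b (y(j := t)))\<^sup>2)" for j y
  define R where "R j i = restrict i (J - {j})" for j and i :: "'a \<Rightarrow> 'b"
  have H0: "H j y \<ge> 0" for j y by (auto simp: H_def intro: sum_nonneg)
  have R_upd: "R j (y(j := t)) = y" if "y \<in> (J - {j}) \<rightarrow>\<^sub>E X" for j y t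
    using that by (simp add: R_def)
  have pointwise: "b i powr (2 * real m / (real m + 1)) \<le>
      ((\<Sum>j\<in>J. (b i)\<^sup>2 * H j (R j i) powr (- 1 / m)) + (\<Prod>j\<in>J. H j (R j i) powr (1 / m))) / (real m + 1)"
    if i: "i \<in> J \<rightarrow>\<^sub>E X" for i
  proof (cases "b i = 0")
    case True
    then show ?thesis by (simp add: prod_nonneg)
  next
    case False
    then have bi: "b i > 0" using b[of i] by simp
    \<comment> \<open>The powers of \<open>H\<close> cancel only where \<open>H\<close> is nonzero;
      the fibre through \<open>i\<close> contains \<open>b i\<close> itself.\<close>
    have Hpos: "H j (R j i) > 0" if "j \<in> J" for j
    proof -
      have "i = (R j i)(j := i j)"
        using i that by (auto simp: R_def PiE_def extensional_def fun_eq_iff)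
      moreover have "i j \<in> X" using i that by auto
      ultimately have "(b i)\<^sup>2 \<le> H j (R j i)"
        unfolding H_def using X by (intro member_le_sum[of "i j" X "\<lambda>t. (b ((R j i)(j := t)))\<^sup>2", THEN order_trans[rotated]]) auto
      then show ?thesis using bi by (smt (verit) zero_less_power)
    qed
    \<comment> \<open>\<open>None\<close> indexes the product term and \<open>Some j\<close> the
      term of direction \<open>j\<close>.\<close>
    define S where "S = insert None (Some ` J)"
    define x where "x = case_option (\<Prod>j\<in>J. H j (R j i) powr (1 / m))
                           (\<lambda>j. (b i)\<^sup>2 * H j (R j i) powr (- 1 / m))"
    have S: "finite S" "S \<noteq> {}" "card S = m + 1"
      using J by (auto simp: S_def card_image)
    have x0: "x k \<ge> 0" for k by (auto simp: x_def prod_nonneg split: option.split)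
    have "(\<Prod>k\<in>S. x k) = (\<Prod>j\<in>J. H j (R j i) powr (1 / m)) * (\<Prod>j\<in>J. (b i)\<^sup>2 * H j (R j i) powr (- 1 / m))"
      using J by (simp add: S_def x_def prod.reindex)
    also have "\<dots> = (\<Prod>j\<in>J. (b i)\<^sup>2)"
      unfolding prod.distrib [symmetric] using Hpos
      by (intro prod.cong refl) (simp add: powr_minus field_simps less_imp_neq [THEN not_sym])
    also have "\<dots> = b i powr (2 * m)"
      using J powr_realpow[OF bi, of "2 * m"] by (simp add: power_mult)
    finally have "(\<Prod>k\<in>S. x k) powr (1 / card S) = b i powr (2 * real m / (real m + 1))"
      using bi S by (simp add: powr_powr add.commute)
    moreover have "(\<Sum>k\<in>S. x k / card S) = ((\<Sum>j\<in>J. x (Some j)) + x None) / (real m + 1)"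
      using J S by (simp add: sum_divide_distrib [symmetric] S_def sum.reindex add.commute)
    ultimately show ?thesis
      using arith_geom_mean[OF S(1,2), of x] x0 by (simp add: x_def)
  qed
  have 1: "(\<Sum>i\<in>J \<rightarrow>\<^sub>E X. (b i)\<^sup>2 * H j (R j i) powr (- 1 / m)) \<le> 1" if j: "j \<in> J" for j
  proof -
    have "(\<Sum>i\<in>J \<rightarrow>\<^sub>E X. (b i)\<^sup>2 * H j (R j i) powr (- 1 / m))
        = (\<Sum>y\<in>(J - {j}) \<rightarrow>\<^sub>E X. H j y * H j y powr (- 1 / m))"
      using sum_PiE_split[OF J(1) X j, of "\<lambda>i. (b i)\<^sup>2 * H j (R j i) powr (- 1 / m)"]
      by (simp add: R_upd H_def [of j] sum_distrib_right)
    also have "\<dots> = (\<Sum>y\<in>(J - {j}) \<rightarrow>\<^sub>E X. H j y powr ((real m - 1) / m))"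
    proof (intro sum.cong refl)
      fix y
      \<comment> \<open>The exponents also add where \<open>H j y = 0\<close>, since
        \<open>0 powr x = 0\<close>.\<close>
      have "(real m - 1) / m = 1 + (- 1 / m)" using J by (simp add: field_simps)
      then show "H j y * H j y powr (- 1 / m) = H j y powr ((real m - 1) / m)"
        using H0[of j y] by (simp only: powr_add) simp
    qed
    also have "\<dots> \<le> 1" using mixed[OF j] by (simp add: H_def)
    finally show ?thesis .
  qed
  have 2: "(\<Sum>i\<in>J \<rightarrow>\<^sub>E X. \<Prod>j\<in>J. H j (R j i) powr (1 / m)) \<le> 1"
  proof -
    have e: "(real m - 1) / m * (1 / (real m - 1)) = 1 / m" using J by (simp add: field_simps)
    have "(\<Sum>i\<in>J \<rightarrow>\<^sub>E X. \<Prod>j\<in>J. H j (R j i) powr (1 / m))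
        = (\<Sum>i\<in>J \<rightarrow>\<^sub>E X. (\<Prod>j\<in>J. H j (R j i) powr ((real m - 1) / m)) powr (1 / (real m - 1)))"
      by (simp only: prod_powr_distrib powr_powr e)
    also have "\<dots> \<le> (\<Prod>j\<in>J. \<Sum>y\<in>(J - {j}) \<rightarrow>\<^sub>E X. H j y powr ((real m - 1) / m)) powr (1 / (real m - 1))"
      unfolding R_def by (intro Loomis_Whitney J X) auto
    also have "\<dots> \<le> 1"
    proof (rule powr_le1)
      have "0 \<le> (\<Prod>j\<in>J. \<Sum>y\<in>(J - {j}) \<rightarrow>\<^sub>E X. H j y powr ((real m - 1) / m))"
        by (intro prod_nonneg sum_nonneg) auto
      moreover have "(\<Prod>j\<in>J. \<Sum>y\<in>(J - {j}) \<rightarrow>\<^sub>E X. H j y powr ((real m - 1) / m)) \<le> 1"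
        using mixed by (intro prod_le_1 conjI sum_nonneg) (auto simp: H_def)
      ultimately show "\<bar>\<Prod>j\<in>J. \<Sum>y\<in>(J - {j}) \<rightarrow>\<^sub>E X. H j y powr ((real m - 1) / m)\<bar> \<le> 1"
        by simp
    qed (use J in simp)
    finally show ?thesis .
  qed
  have "(\<Sum>i\<in>J \<rightarrow>\<^sub>E X. b i powr (2 * real m / (real m + 1))) \<le>
      (\<Sum>i\<in>J \<rightarrow>\<^sub>E X. ((\<Sum>j\<in>J. (b i)\<^sup>2 * H j (R j i) powr (- 1 / m))
         + (\<Prod>j\<in>J. H j (R j i) powr (1 / m))) / (real m + 1))"
    by (intro sum_mono pointwise)
  also have "\<dots> = ((\<Sum>j\<in>J. \<Sum>i\<in>J \<rightarrow>\<^sub>E X. (b i)\<^sup>2 * H j (R j i) powr (- 1 / m))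
         + (\<Sum>i\<in>J \<rightarrow>\<^sub>E X. \<Prod>j\<in>J. H j (R j i) powr (1 / m))) / (real m + 1)"
    unfolding sum_divide_distrib [symmetric] sum.distrib by (subst sum.swap) (rule refl)
  also have "\<dots> \<le> ((\<Sum>j\<in>J. 1) + 1) / (real m + 1)"
    by (intro divide_right_mono add_mono sum_mono 1 2) auto
  also have "\<dots> = 1" using J by simp
  finally show ?thesis .
qed

text \<open>By homogeneity, replacing \<open>b\<close> with \<open>b / D\<close> reduces this to the
  normalized case.\<close>

lemma Blei_inequality:
  fixes b :: "('a \<Rightarrow> 'b) \<Rightarrow> real"
  assumes J: "finite J" "card J = m" "m \<ge> 2" and X: "finite X"
    and b: "\<And>i. b i \<ge> 0" and D: "D > 0"
    and mixed: "\<And>j. j \<in> J \<Longrightarrow>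
      (\<Sum>y\<in>(J - {j}) \<rightarrow>\<^sub>E X. (\<Sum>t\<in>X. (b (y(j := t)))\<^sup>2) powr ((real m - 1) / m))
        \<le> D powr (2 * (real m - 1) / m)"
  shows "(\<Sum>i\<in>J \<rightarrow>\<^sub>E X. b i powr (2 * real m / (real m + 1))) \<le> D powr (2 * real m / (real m + 1))"
proof -
  have "(\<Sum>i\<in>J \<rightarrow>\<^sub>E X. (b i / D) powr (2 * real m / (real m + 1))) \<le> 1"
  proof (rule Blei_normalized[OF J X, where b = "\<lambda>i. b i / D"])
    fix j assume j: "j \<in> J"
    have "(\<Sum>t\<in>X. (b (y(j := t)) / D)\<^sup>2) powr ((real m - 1) / m)
       = (\<Sum>t\<in>X. (b (y(j := t)))\<^sup>2) powr ((real m - 1) / m) / D powr (2 * (real m - 1) / m)" for y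
    proof -
      have "(D\<^sup>2) powr ((real m - 1) / m) = D powr (2 * (real m - 1) / m)"
        using D powr_powr[of D 2 "(real m - 1) / m"] by simp
      then show ?thesis
        using D by (simp add: power_divide sum_divide_distrib [symmetric] powr_divide sum_nonneg)
    qed
    then show "(\<Sum>y\<in>(J - {j}) \<rightarrow>\<^sub>E X. (\<Sum>t\<in>X. (b (y(j := t)) / D)\<^sup>2) powr ((real m - 1) / m)) \<le> 1"
      using mixed[OF j] D by (simp add: sum_divide_distrib [symmetric])
  qed (use b D in auto)
  then show ?thesis
    using D b by (simp add: powr_divide sum_divide_distrib [symmetric])
qed

section \<open>Khinchine's inequality\<close>

text \<open>The set \<open>A\<close> encodes a choice of signs, plus on \<open>A\<close> and minus
  off it, so expectations become sums over \<open>Pow X\<close> divided by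
  \<open>2 ^ card X\<close>.\<close>

definition rademacher_sum :: "'b set \<Rightarrow> ('b \<Rightarrow> complex) \<Rightarrow> 'b set \<Rightarrow> complex" where
  "rademacher_sum X a A = (\<Sum>t\<in>X. if t \<in> A then a t else - a t)"

lemma sum_Pow_insert:
  fixes g :: "'b set \<Rightarrow> 'c::comm_monoid_add"
  assumes "finite X" "v \<notin> X"
  shows "(\<Sum>A\<in>Pow (insert v X). g A) = (\<Sum>A\<in>Pow X. g A + g (insert v A))"
proof -
  have "inj_on (insert v) (Pow X)"
    using assms(2) by (fastforce simp: inj_on_def)
  moreover have "Pow X \<inter> insert v ` Pow X = {}" using assms(2) by auto
  ultimately show ?thesis
    using assms(1) unfolding Pow_insert by (simp add: sum.union_disjoint sum.reindex sum.distrib)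
qed

text \<open>Grouping the sign patterns by the sign of \<open>v\<close> makes moments accessible to
  induction on \<open>X\<close>.\<close>

lemma sum_rademacher_insert:
  assumes "finite X" "v \<notin> X"
  shows "(\<Sum>A\<in>Pow (insert v X). h (rademacher_sum (insert v X) a A))
    = (\<Sum>A\<in>Pow X. h (rademacher_sum X a A - a v) + h (rademacher_sum X a A + a v))"
  unfolding sum_Pow_insert[OF assms]
proof (intro sum.cong refl)
  fix A assume A: "A \<in> Pow X"
  have "rademacher_sum X a (insert v A) = rademacher_sum X a A"
    unfolding rademacher_sum_def using assms(2) by (intro sum.cong refl) auto
  moreover have "v \<notin> A" using A assms(2) by auto
  ultimately show "h (rademacher_sum (insert v X) a A) + h (rademacher_sum (insert v X) a (insert v A))
      = h (rademacher_sum X a A - a v) + h (rademacher_sum X a A + a v)"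
    using assms by (simp add: rademacher_sum_def add.commute)
qed

text \<open>With \<open>r\<close> the real part of \<open>z * cnj w\<close>, the squared moduli of
  \<open>z + w\<close> and \<open>z - w\<close> are one number plus and minus \<open>2 * r\<close>.
  Squaring and adding leaves the cross term \<open>8 * r\<^sup>2\<close>, which Cauchy--Schwarz
  bounds.\<close>

lemma norm_fourth_power_sum_le:
  fixes z w :: complex
  shows "(cmod (z - w))^4 + (cmod (z + w))^4 \<le> 2 * (cmod z)^4 + 12 * (cmod z)\<^sup>2 * (cmod w)\<^sup>2 + 2 * (cmod w)^4"
proof -
  have 4: "(cmod u)^4 = ((cmod u)\<^sup>2)\<^sup>2" for u by simp
  define r where "r = Re z * Re w + Im z * Im w"
  have "r\<^sup>2 \<le> (cmod z)\<^sup>2 * (cmod w)\<^sup>2"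
  proof -
    have "(cmod z)\<^sup>2 * (cmod w)\<^sup>2 = r\<^sup>2 + (Re z * Im w - Im z * Re w)\<^sup>2"
      unfolding cmod_power2 r_def by algebra
    then show ?thesis by simp
  qed
  moreover have "(cmod (z - w))^4 + (cmod (z + w))^4
      = 2 * (cmod z)^4 + 4 * ((cmod z)\<^sup>2 * (cmod w)\<^sup>2) + 2 * (cmod w)^4 + 8 * r\<^sup>2"
    unfolding 4 cmod_power2 r_def by (simp add: algebra_simps power2_eq_square)
  ultimately show ?thesis by (simp add: mult_ac)
qed

lemma rademacher_second_moment:
  assumes "finite X"
  shows "(\<Sum>A\<in>Pow X. (cmod (rademacher_sum X a A))\<^sup>2) = 2 ^ card X * (\<Sum>t\<in>X. (cmod (a t))\<^sup>2)"
  using assms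
proof induction
  case empty
  then show ?case by (simp add: rademacher_sum_def)
next
  case (insert v X)
  have "(cmod (z - w))\<^sup>2 + (cmod (z + w))\<^sup>2 = 2 * (cmod z)\<^sup>2 + 2 * (cmod w)\<^sup>2" for z w
    unfolding cmod_power2 by (simp add: algebra_simps power2_eq_square)
  then have "(\<Sum>A\<in>Pow (insert v X). (cmod (rademacher_sum (insert v X) a A))\<^sup>2)
      = (\<Sum>A\<in>Pow X. 2 * (cmod (rademacher_sum X a A))\<^sup>2 + 2 * (cmod (a v))\<^sup>2)"
    unfolding sum_rademacher_insert[OF insert.hyps, of "\<lambda>z. (cmod z)\<^sup>2"] by simp
  also have "\<dots> = 2 * (\<Sum>A\<in>Pow X. (cmod (rademacher_sum X a A))\<^sup>2) + 2 ^ card X * (2 * (cmod (a v))\<^sup>2)"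
    by (simp add: sum.distrib sum_distrib_left card_Pow insert.hyps)
  finally show ?case using insert by (simp add: algebra_simps)
qed

lemma rademacher_fourth_moment:
  assumes "finite X"
  shows "(\<Sum>A\<in>Pow X. (cmod (rademacher_sum X a A))^4) \<le> 3 * 2 ^ card X * (\<Sum>t\<in>X. (cmod (a t))\<^sup>2)\<^sup>2"
  using assms
proof induction
  case empty
  then show ?case by (simp add: rademacher_sum_def)
next
  case (insert v X)
  define V where "V = (\<Sum>t\<in>X. (cmod (a t))\<^sup>2)"
  define w where "w = (cmod (a v))\<^sup>2"
  have w4: "(cmod (a v))^4 = w\<^sup>2" by (simp add: w_def)
  have "(\<Sum>A\<in>Pow (insert v X). (cmod (rademacher_sum (insert v X) a A))^4)
      \<le> (\<Sum>A\<in>Pow X. 2 * (cmod (rademacher_sum X a A))^4 + 12 * (cmod (rademacher_sum X a A))\<^sup>2 * w + 2 * w\<^sup>2)"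
    unfolding sum_rademacher_insert[OF insert.hyps, of "\<lambda>z. cmod z ^ 4"]
    unfolding w4 [symmetric] unfolding w_def by (intro sum_mono norm_fourth_power_sum_le)
  also have "\<dots> = 2 * (\<Sum>A\<in>Pow X. (cmod (rademacher_sum X a A))^4)
      + 12 * w * (\<Sum>A\<in>Pow X. (cmod (rademacher_sum X a A))\<^sup>2) + 2 ^ card X * (2 * w\<^sup>2)"
    by (simp add: sum.distrib sum_distrib_left card_Pow insert.hyps mult_ac)
  \<comment> \<open>Enlarging \<open>2 * w\<^sup>2\<close> to \<open>6 * w\<^sup>2\<close> completes
    the square \<open>(w + V)\<^sup>2\<close>; the constant 3 is what makes the cross terms
    match.\<close>
  also have "\<dots> \<le> 2 * (3 * 2 ^ card X * V\<^sup>2) + 12 * w * (2 ^ card X * V) + 2 ^ card X * (6 * w\<^sup>2)"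
    using insert.IH rademacher_second_moment[OF insert.hyps(1), of a]
    by (intro add_mono) (auto simp: V_def)
  also have "\<dots> = 3 * 2 ^ card (insert v X) * (w + V)\<^sup>2"
    using insert.hyps by (simp add: power2_eq_square algebra_simps)
  finally show ?case using insert.hyps by (simp add: V_def w_def)
qed

text \<open>Interpolating the second moment between the \<open>q\<close>-th and the fourth one keeps the constant
  close to 1 for \<open>q\<close> close to 2; this is what makes the constants of the induction below
  multiply up to a polynomial.\<close>
theorem Khinchine_inequality:
  fixes a :: "'b \<Rightarrow> complex"
  assumes X: "finite X" and q: "0 < q" "q < 2"
  shows "2 ^ card X * (\<Sum>t\<in>X. (cmod (a t))\<^sup>2) powr (q / 2)
    \<le> 3 powr ((2 - q) / 2) * (\<Sum>A\<in>Pow X. cmod (rademacher_sum X a A) powr q)"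
proof (cases "(\<Sum>t\<in>X. (cmod (a t))\<^sup>2) = 0")
  case True
  then show ?thesis by (simp add: sum_nonneg)
next
  case False
  define V where "V = (\<Sum>t\<in>X. (cmod (a t))\<^sup>2)"
  define n :: real where "n = 2 ^ card X"
  \<comment> \<open>The weight for which 2 is the average of \<open>q\<close> and 4 with weights
    \<theta> and \<open>1 - \<theta>\<close>.\<close>
  define \<theta> where "\<theta> = 2 / (4 - q)"
  define s where "s = (3::real) powr ((2 - q) / 2)"
  define u where "u A = cmod (rademacher_sum X a A) / sqrt V" for A
  have V: "V > 0" using False by (simp add: V_def sum_nonneg less_le)
  have h: "(4 - q) * \<theta> = 2" using q by (simp add: \<theta>_def field_simps)
  have \<theta>: "q * \<theta> + 4 * (1 - \<theta>) = 2" "(2 - q) / 2 * \<theta> = 1 - \<theta>"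
    using h by argo+
  have \<theta>01: "0 < \<theta>" "\<theta> < 1" using q by (auto simp: \<theta>_def)
  \<comment> \<open>Weighted Young inequality; \<open>s\<close> is chosen so that
    \<open>s powr \<theta>\<close> cancels the \<open>3 powr (1 - \<theta>)\<close> coming from the
    fourth power.\<close>
  have young: "u A ^ 2 \<le> \<theta> * (s * u A powr q) + (1 - \<theta>) * (u A ^ 4 / 3)" for A
  proof (cases "u A = 0")
    case False
    then have u: "u A > 0" using V by (simp add: u_def)
    then have u4: "u A ^ 4 = u A powr 4" by simp
    have "(s * u A powr q) powr \<theta> * (u A ^ 4 / 3) powr (1 - \<theta>)
        = (3 powr (1 - \<theta>) * u A powr (q * \<theta>)) * (u A powr (4 * (1 - \<theta>)) / 3 powr (1 - \<theta>))"
      unfolding u4 s_def powr_mult powr_powr powr_divide \<theta>(2) ..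
    also have "\<dots> = u A powr (q * \<theta> + 4 * (1 - \<theta>))"
      by (simp only: powr_add) simp
    also have "\<dots> = u A ^ 2" unfolding \<theta>(1) using u by simp
    finally show ?thesis
      using Youngs_inequality_0[of \<theta> "1 - \<theta>" "s * u A powr q" "u A ^ 4 / 3"] \<theta>01 u
      by (simp add: s_def)
  qed (use q in simp)
  have 2: "(\<Sum>A\<in>Pow X. u A ^ 2) = n"
    using rademacher_second_moment[OF X, of a] V
    by (simp add: u_def power_divide sum_divide_distrib [symmetric] V_def n_def)
  have 4: "(\<Sum>A\<in>Pow X. u A ^ 4) \<le> 3 * n"
  proof -
    have "sqrt V ^ 4 = V\<^sup>2" using V by (simp add: power4_eq_xxxx power2_eq_square)
    then show ?thesis
      using rademacher_fourth_moment[OF X, of a] V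
      by (simp add: u_def power_divide sum_divide_distrib [symmetric] V_def n_def field_simps)
  qed
  have "n \<le> (\<Sum>A\<in>Pow X. \<theta> * (s * u A powr q) + (1 - \<theta>) * (u A ^ 4 / 3))"
    unfolding 2 [symmetric] by (intro sum_mono young)
  also have "\<dots> = \<theta> * (s * (\<Sum>A\<in>Pow X. u A powr q)) + (1 - \<theta>) * ((\<Sum>A\<in>Pow X. u A ^ 4) / 3)"
    by (simp add: sum.distrib sum_distrib_left sum_divide_distrib)
  also have "\<dots> \<le> \<theta> * (s * (\<Sum>A\<in>Pow X. u A powr q)) + (1 - \<theta>) * n"
    using 4 \<theta>01 by (intro add_mono order.refl mult_left_mono) auto
  \<comment> \<open>The fourth moment costs only \<open>(1 - \<theta>) * n\<close>, which is
    subtracted from both sides.\<close>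
  finally have "\<theta> * n \<le> \<theta> * (s * (\<Sum>A\<in>Pow X. u A powr q))" by (simp add: algebra_simps)
  then have "n \<le> s * (\<Sum>A\<in>Pow X. u A powr q)" using \<theta>01 by simp
  moreover have "(\<Sum>A\<in>Pow X. u A powr q) = (\<Sum>A\<in>Pow X. cmod (rademacher_sum X a A) powr q) / V powr (q / 2)"
  proof -
    have "sqrt V powr q = V powr (q / 2)" using V by (simp add: powr_half_sqrt [symmetric] powr_powr)
    then show ?thesis by (simp add: u_def powr_divide sum_divide_distrib)
  qed
  ultimately show ?thesis using V by (simp add: n_def s_def V_def field_simps)
qed

section \<open>The multilinear Bohnenblust--Hille inequality\<close>

text \<open>Variables are labelled by a set \<open>J\<close> and multi-indices are functions on it,
  so fixing variable \<open>v\<close> gives a form over \<open>J - {v}\<close> without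
  renumbering.\<close>

definition multilinear_form ::
  "'a set \<Rightarrow> 'b set \<Rightarrow> (('a \<Rightarrow> 'b) \<Rightarrow> complex) \<Rightarrow> ('a \<Rightarrow> 'b \<Rightarrow> complex) \<Rightarrow> complex" where
  "multilinear_form J X a x = (\<Sum>i\<in>J \<rightarrow>\<^sub>E X. a i * (\<Prod>k\<in>J. x k (i k)))"

text \<open>Stating a bound on the sup norm as a predicate keeps suprema out of the
  induction.\<close>

definition form_bounded ::
  "'a set \<Rightarrow> 'b set \<Rightarrow> (('a \<Rightarrow> 'b) \<Rightarrow> complex) \<Rightarrow> real \<Rightarrow> bool" where
  "form_bounded J X a D \<longleftrightarrow>
    (\<forall>x. (\<forall>k\<in>J. \<forall>t\<in>X. cmod (x k t) \<le> 1) \<longrightarrow> cmod (multilinear_form J X a x) \<le> D)"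

lemma form_bounded_slice:
  assumes J: "finite J" "v \<in> J" and X: "finite X" and a: "form_bounded J X a D"
    and e: "\<And>t. t \<in> X \<Longrightarrow> cmod (e t) \<le> 1"
  shows "form_bounded (J - {v}) X (\<lambda>y. \<Sum>t\<in>X. e t * a (y(v := t))) D"
  unfolding form_bounded_def
proof (intro allI impI)
  fix x assume x: "\<forall>k\<in>J - {v}. \<forall>t\<in>X. cmod (x k t) \<le> 1"
  have "multilinear_form J X a (x(v := e)) = (\<Sum>y\<in>(J - {v}) \<rightarrow>\<^sub>E X. \<Sum>t\<in>X.
      a (y(v := t)) * (\<Prod>k\<in>J. (x(v := e)) k ((y(v := t)) k)))"
    unfolding multilinear_form_def by (rule sum_PiE_split) (use J X in auto)
  also have "\<dots> = multilinear_form (J - {v}) X (\<lambda>y. \<Sum>t\<in>X. e t * a (y(v := t))) x"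
    unfolding multilinear_form_def sum_distrib_right
  proof (intro sum.cong refl)
    fix y t
    have "(\<Prod>k\<in>J. (x(v := e)) k ((y(v := t)) k))
        = e t * (\<Prod>k\<in>J - {v}. (x(v := e)) k ((y(v := t)) k))"
      using J by (simp add: prod.remove)
    also have "(\<Prod>k\<in>J - {v}. (x(v := e)) k ((y(v := t)) k)) = (\<Prod>k\<in>J - {v}. x k (y k))"
      by (intro prod.cong refl) auto
    finally show "a (y(v := t)) * (\<Prod>k\<in>J. (x(v := e)) k ((y(v := t)) k))
        = e t * a (y(v := t)) * (\<Prod>k\<in>J - {v}. x k (y k))"
      by simp
  qed
  finally show "cmod (multilinear_form (J - {v}) X (\<lambda>y. \<Sum>t\<in>X. e t * a (y(v := t))) x) \<le> D"
    using a [unfolded form_bounded_def, rule_format, of "x(v := e)"] x e by simp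
qed

text \<open>After Khinchine's inequality on each fibre and an exchange of sums, every sign pattern
  leaves a form in one variable fewer, to which the bound \<open>M\<close> applies. As
  \<open>(2 - q) / 2 = 1 / m\<close>, the cost is only \<open>3 powr (1 / m)\<close>.\<close>

lemma mixed_norm_le_of_slices:
  assumes J: "finite J" "card J = m" "m \<ge> 2" "v \<in> J" and X: "finite X"
    and a: "form_bounded J X a D"
    and slices: "\<And>a'. form_bounded (J - {v}) X a' D \<Longrightarrow>
      (\<Sum>y\<in>(J - {v}) \<rightarrow>\<^sub>E X. cmod (a' y) powr (2 * (real m - 1) / m)) \<le> M"
  shows "(\<Sum>y\<in>(J - {v}) \<rightarrow>\<^sub>E X. (\<Sum>t\<in>X. (cmod (a (y(v := t))))\<^sup>2) powr ((real m - 1) / m))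
    \<le> 3 powr (1 / m) * M"
proof -
  define q where "q = 2 * (real m - 1) / m"
  have q: "0 < q" "q < 2" "q / 2 = (real m - 1) / m" "(2 - q) / 2 = 1 / m"
    using J by (auto simp: q_def field_simps)
  define Y where "Y = (J - {v}) \<rightarrow>\<^sub>E X"
  define f where "f y = rademacher_sum X (\<lambda>t. a (y(v := t)))" for y
  have sl: "(\<Sum>y\<in>Y. cmod (f y A) powr q) \<le> M" for A
  proof -
    define e where "e t = (if t \<in> A then 1 else - 1 :: complex)" for t
    have "f y A = (\<Sum>t\<in>X. e t * a (y(v := t)))" for y
      by (auto simp: f_def rademacher_sum_def e_def intro!: sum.cong)
    moreover have "form_bounded (J - {v}) X (\<lambda>y. \<Sum>t\<in>X. e t * a (y(v := t))) D"
      by (rule form_bounded_slice[OF J(1,4) X a]) (simp add: e_def)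
    ultimately show ?thesis using slices by (simp add: q_def Y_def)
  qed
  have "2 ^ card X * (\<Sum>y\<in>Y. (\<Sum>t\<in>X. (cmod (a (y(v := t))))\<^sup>2) powr (q / 2))
      \<le> (\<Sum>y\<in>Y. 3 powr ((2 - q) / 2) * (\<Sum>A\<in>Pow X. cmod (f y A) powr q))"
    unfolding sum_distrib_left f_def
    using Khinchine_inequality[OF X q(1,2)] by (intro sum_mono) (simp add: sum_distrib_left)
  also have "\<dots> = 3 powr ((2 - q) / 2) * (\<Sum>A\<in>Pow X. \<Sum>y\<in>Y. cmod (f y A) powr q)"
    by (simp add: sum_distrib_left sum.swap[of _ Y])
  also have "\<dots> \<le> 3 powr ((2 - q) / 2) * (\<Sum>A\<in>Pow X. M)"
    by (intro mult_left_mono sum_mono sl) auto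
  also have "\<dots> = 2 ^ card X * (3 powr ((2 - q) / 2) * M)"
    using X by (simp add: card_Pow)
  finally show ?thesis unfolding q Y_def by simp
qed

text \<open>This is \<open>1 - x \<le> exp (- x)\<close> at \<open>x = 1 / (m + 1)\<close>, combined
  with \<open>3 \<le> exp 2\<close>. Over the induction on the number of variables the right sides
  telescope to the square of that number.\<close>

lemma three_powr_inverse_Suc_le:
  assumes "m \<ge> 1"
  shows "3 powr (1 / real (Suc m)) \<le> (real (Suc m) / real m)\<^sup>2"
proof -
  have "3 \<le> exp (2::real)" using exp_ge_add_one_self[of 2] by simp
  then have "3 powr (1 / real (Suc m)) \<le> exp 2 powr (1 / real (Suc m))"
    by (intro powr_mono2) auto
  also have "\<dots> = (exp (1 / real (Suc m)))\<^sup>2"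
    by (simp add: powr_def exp_double [symmetric] mult_ac)
  also have "\<dots> \<le> (real (Suc m) / real m)\<^sup>2"
  proof (rule power_mono)
    have "real m / real (Suc m) \<le> exp (- (1 / real (Suc m)))"
      using exp_ge_add_one_self[of "- (1 / real (Suc m))"] by (simp add: field_simps)
    then show "exp (1 / real (Suc m)) \<le> real (Suc m) / real m"
      using assms by (simp add: exp_minus field_simps)
  qed simp
  finally show ?thesis .
qed

lemma BH_constant_step:
  assumes "m \<ge> 1" "D > 0" "q \<ge> 1"
  shows "3 powr (1 / real (Suc m)) * (real m ^ 2 * D) powr q \<le> (real (Suc m) ^ 2 * D) powr q"
proof -
  define r where "r = (real (Suc m) / real m)\<^sup>2"
  have "r \<ge> 1" using assms by (auto simp: r_def field_simps)
  then have "r \<le> r powr q" using powr_mono[of 1 q r] assms by simp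
  then have "3 powr (1 / real (Suc m)) * (real m ^ 2 * D) powr q \<le> r powr q * (real m ^ 2 * D) powr q"
    using three_powr_inverse_Suc_le[OF assms(1)] by (intro mult_right_mono) (auto simp: r_def)
  also have "\<dots> = (real (Suc m) ^ 2 * D) powr q"
    using assms by (simp add: powr_mult [symmetric] r_def power_divide)
  finally show ?thesis .
qed

text \<open>Used twice: with the induction hypothesis inside \<open>Bohnenblust_Hille\<close>, and
  with that theorem itself for the mixed norms afterwards.\<close>

lemma mixed_norm_le_step:
  fixes a :: "('a \<Rightarrow> 'b) \<Rightarrow> complex"
  assumes m: "m \<ge> 1" and J: "finite J" "card J = Suc m" "j \<in> J" and X: "finite X"
    and a: "form_bounded J X a D" and D: "D > 0"
    and slices: "\<And>a'. form_bounded (J - {j}) X a' D \<Longrightarrow>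
      (\<Sum>y\<in>(J - {j}) \<rightarrow>\<^sub>E X. cmod (a' y) powr (2 * real m / (real m + 1)))
        \<le> (real m ^ 2 * D) powr (2 * real m / (real m + 1))"
  shows "(\<Sum>y\<in>(J - {j}) \<rightarrow>\<^sub>E X. (\<Sum>t\<in>X. (cmod (a (y(j := t))))\<^sup>2) powr ((real (Suc m) - 1) / Suc m))
    \<le> (real (Suc m) ^ 2 * D) powr (2 * (real (Suc m) - 1) / Suc m)"
proof -
  \<comment> \<open>The mixed exponent for \<open>Suc m\<close> variables is the Bohnenblust--Hille
    exponent for \<open>m\<close>, so the slices fall under the case \<open>m\<close>.\<close>
  have e: "2 * (real (Suc m) - 1) / Suc m = 2 * real m / (real m + 1)" by (simp add: add.commute)
  have "(\<Sum>y\<in>(J - {j}) \<rightarrow>\<^sub>E X. (\<Sum>t\<in>X. (cmod (a (y(j := t))))\<^sup>2) powr ((real (Suc m) - 1) / Suc m))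
    \<le> 3 powr (1 / Suc m) * (real m ^ 2 * D) powr (2 * real m / (real m + 1))"
  proof (rule mixed_norm_le_of_slices[OF J(1,2) _ J(3) X a])
    fix a' :: "('a \<Rightarrow> 'b) \<Rightarrow> complex" assume "form_bounded (J - {j}) X a' D"
    then show "(\<Sum>y\<in>(J - {j}) \<rightarrow>\<^sub>E X. cmod (a' y) powr (2 * (real (Suc m) - 1) / Suc m))
        \<le> (real m ^ 2 * D) powr (2 * real m / (real m + 1))"
      unfolding e by (rule slices)
  qed (use m in simp)
  also have "\<dots> \<le> (real (Suc m) ^ 2 * D) powr (2 * real m / (real m + 1))"
    using m D by (intro BH_constant_step) (auto simp: field_simps)
  finally show ?thesis unfolding e .
qed

text \<open>Induction on the number of variables: the hypothesis bounds all slices, hence every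
  mixed norm, and Blei's inequality combines these without changing the constant.\<close>

theorem Bohnenblust_Hille:
  fixes a :: "('a \<Rightarrow> 'b) \<Rightarrow> complex"
  assumes "m \<ge> 1" "finite J" "card J = m" "finite X" "form_bounded J X a D" "D > 0"
  shows "(\<Sum>i\<in>J \<rightarrow>\<^sub>E X. cmod (a i) powr (2 * real m / (real m + 1)))
    \<le> (real m ^ 2 * D) powr (2 * real m / (real m + 1))"
  using assms(1,2,3,5)
proof (induction m arbitrary: J a rule: nat_induct_at_least)
  case base
  then obtain v where J: "J = {v}" by (auto simp: card_Suc_eq)
  \<comment> \<open>The conjugate phases of the coefficients turn every term into its modulus;
    \<open>\<lambda>w\<in>{v}. t\<close> is the multi-index with value \<open>t\<close>.\<close>
  define x where "x k t = cnj (sgn (a (\<lambda>w\<in>{v}. t)))" for k :: 'a and t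
  have cnj_sgn: "z * cnj (sgn z) = of_real (cmod z)" for z
    using complex_norm_square[of z] by (cases "z = 0") (simp_all add: sgn_eq field_simps power2_eq_square)
  have "a i * (\<Prod>k\<in>J. x k (i k)) = of_real (cmod (a i))" if "i \<in> J \<rightarrow>\<^sub>E X" for i
  proof -
    have "(\<lambda>w\<in>{v}. i v) = i" using that J by (auto simp: PiE_def extensional_def restrict_def)
    then show ?thesis
      using cnj_sgn[of "a i"] by (simp add: J x_def)
  qed
  then have "multilinear_form J X a x = of_real (\<Sum>i\<in>J \<rightarrow>\<^sub>E X. cmod (a i))"
    unfolding multilinear_form_def by simp
  moreover have "cmod (multilinear_form J X a x) \<le> D"
    using base.prems(3) by (auto simp: form_bounded_def x_def norm_sgn)
  moreover have "(\<Sum>i\<in>J \<rightarrow>\<^sub>E X. cmod (a i)) \<ge> 0" by (intro sum_nonneg) auto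
  ultimately show ?case using \<open>D > 0\<close> by (simp del: of_real_sum)
next
  case (Suc m)
  have "(\<Sum>i\<in>J \<rightarrow>\<^sub>E X. cmod (a i) powr (2 * real (Suc m) / (real (Suc m) + 1)))
    \<le> (real (Suc m) ^ 2 * D) powr (2 * real (Suc m) / (real (Suc m) + 1))"
  proof (rule Blei_inequality)
    fix j assume "j \<in> J"
    then show "(\<Sum>y\<in>(J - {j}) \<rightarrow>\<^sub>E X. (\<Sum>t\<in>X. (cmod (a (y(j := t))))\<^sup>2) powr ((real (Suc m) - 1) / Suc m))
        \<le> (real (Suc m) ^ 2 * D) powr (2 * (real (Suc m) - 1) / Suc m)"
      using Suc assms by (intro mixed_norm_le_step) auto
  qed (use Suc assms in auto)
  then show ?case .
qed

text \<open>The Lorentz estimate needs the mixed norms themselves, as Fournier's inequality takes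
  the place of Blei's there.\<close>

corollary Bohnenblust_Hille_mixed:
  fixes a :: "('a \<Rightarrow> 'b) \<Rightarrow> complex"
  assumes "m \<ge> 2" "finite J" "card J = m" "finite X" "form_bounded J X a D" "D > 0" "j \<in> J"
  shows "(\<Sum>y\<in>(J - {j}) \<rightarrow>\<^sub>E X. (\<Sum>t\<in>X. (cmod (a (y(j := t))))\<^sup>2) powr ((real m - 1) / m))
    \<le> (real m ^ 2 * D) powr (2 * (real m - 1) / m)"
proof -
  obtain l where l: "m = Suc l" "l \<ge> 1" using assms(1) by (cases m) auto
  show ?thesis
    unfolding l(1) using assms l by (intro mixed_norm_le_step Bohnenblust_Hille) auto
qed

section \<open>Fournier's inequality\<close>

text \<open>Obtained from the \<open>m\<close>-fold version by taking \<open>u\<close> once and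
  \<open>v\<close> \<open>m - 1\<close> times.\<close>

lemma Hoelder_sum_two:
  fixes u v :: "'t \<Rightarrow> real"
  assumes m: "m \<ge> 2" and u: "\<And>t. t \<in> X \<Longrightarrow> u t \<ge> 0" and v: "\<And>t. t \<in> X \<Longrightarrow> v t \<ge> 0"
  shows "(\<Sum>t\<in>X. u t powr (1 / m) * v t powr ((real m - 1) / m))
    \<le> (\<Sum>t\<in>X. u t) powr (1 / m) * (\<Sum>t\<in>X. v t) powr ((real m - 1) / m)"
proof -
  obtain n where n: "m = Suc n" using m by (cases m) auto
  have pw: "(a * b ^ n) powr (1 / m) = a powr (1 / m) * b powr ((real m - 1) / m)"
    if "b \<ge> 0" for a b :: real
  proof -
    have "(b ^ n) powr (1 / m) = b powr (real n / m)"
    proof (cases "b = 0")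
      case False
      then show ?thesis using that by (simp add: powr_realpow [symmetric] powr_powr)
    qed (use m n in auto)
    then show ?thesis by (simp add: powr_mult n)
  qed
  have pr: "(\<Prod>k\<in>{..<m}. if k = 0 then a else b) = a * b ^ n" for a b :: real
    unfolding n prod.lessThan_Suc_shift by simp
  have "(\<Sum>t\<in>X. u t powr (1 / m) * v t powr ((real m - 1) / m))
      = (\<Sum>t\<in>X. (\<Prod>k\<in>{..<m}. if k = 0 then u t else v t) powr (1 / m))"
    using v by (intro sum.cong refl) (simp only: pr pw)
  also have "\<dots> \<le> (\<Prod>k\<in>{..<m}. \<Sum>t\<in>X. if k = 0 then u t else v t) powr (1 / m)"
    using m u v by (intro Hoelder_sum_prod) auto
  also have "(\<Prod>k\<in>{..<m}. \<Sum>t\<in>X. if k = 0 then u t else v t)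
      = (\<Prod>k\<in>{..<m}. if k = 0 then \<Sum>t\<in>X. u t else \<Sum>t\<in>X. v t)"
    by (intro prod.cong) auto
  also have "\<dots> powr (1 / m) = ((\<Sum>t\<in>X. u t) * (\<Sum>t\<in>X. v t) ^ n) powr (1 / m)"
    by (simp only: pr)
  also have "\<dots> = (\<Sum>t\<in>X. u t) powr (1 / m) * (\<Sum>t\<in>X. v t) powr ((real m - 1) / m)"
    using v by (intro pw sum_nonneg)
  finally show ?thesis .
qed

section \<open>Power sums and summation by parts\<close>

text \<open>Bernoulli's inequality \<open>(1 - 1 / k) powr s \<le> 1 - s / k\<close>, itself a
  weighted Young inequality, multiplied by \<open>k powr s\<close>.\<close>

lemma powr_diff_ge:
  fixes s :: real
  assumes s: "0 < s" "s \<le> 1" and k: "k \<ge> 1"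
  shows "real k powr s - (real k - 1) powr s \<ge> s * real k powr (s - 1)"
proof (cases "k = 1")
  case False
  then have k2: "k \<ge> 2" using k by simp
  have "((real k - 1) / k) powr s * 1 powr (1 - s) \<le> s * ((real k - 1) / k) + (1 - s) * 1"
    using s k2 by (intro Youngs_inequality_0) auto
  then have "((real k - 1) / k) powr s \<le> 1 - s / k" using k2 by (simp add: field_simps)
  then have "real k powr s * ((real k - 1) / k) powr s \<le> real k powr s * (1 - s / k)"
    by (intro mult_left_mono) auto
  moreover have "real k powr s * ((real k - 1) / k) powr s = (real k - 1) powr s"
    using k2 by (simp add: powr_divide)
  ultimately show ?thesis using k2 by (simp add: powr_diff algebra_simps)
qed (use s in simp)

text \<open>Telescoping of \<open>powr_diff_ge\<close> with \<open>s = (m - 1) / m\<close>; the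
  factor 2 covers \<open>1 / s\<close>.\<close>

lemma sum_powr_minus_le:
  assumes "m \<ge> 2"
  shows "(\<Sum>l=1..k. real l powr (- 1 / real m)) \<le> 2 * real k powr ((real m - 1) / m)"
proof (induction k)
  case (Suc k)
  define s where "s = (real m - 1) / m"
  have s: "1 / 2 \<le> s" "s \<le> 1" "s - 1 = - 1 / real m" using assms by (auto simp: s_def field_simps)
  have "1 / 2 * real (Suc k) powr (s - 1) \<le> s * real (Suc k) powr (s - 1)"
    using s by (intro mult_right_mono) auto
  also have "\<dots> \<le> real (Suc k) powr s - real k powr s"
    using powr_diff_ge[of s "Suc k"] s by simp
  finally have "real (Suc k) powr (- 1 / real m) \<le> 2 * real (Suc k) powr s - 2 * real k powr s"
    unfolding s(3) by simp
  then show ?case using Suc.IH by (simp add: s_def)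
qed simp

text \<open>Summation by parts as an induction: passing from \<open>h n\<close> to
  \<open>h (Suc n)\<close> can only lower the bound, as the partial sums of \<open>c\<close> are
  nonnegative.\<close>

lemma sum_mult_antimono_ge:
  fixes c h :: "nat \<Rightarrow> real"
  assumes "\<And>k. k \<in> {1..n} \<Longrightarrow> (\<Sum>l=1..k. c l) \<ge> 0"
    and "\<And>k l. 1 \<le> k \<Longrightarrow> k \<le> l \<Longrightarrow> l \<le> n \<Longrightarrow> h l \<le> h k"
  shows "(\<Sum>l=1..n. c l * h l) \<ge> h n * (\<Sum>l=1..n. c l)"
  using assms
proof (induction n)
  case (Suc n)
  have "h (Suc n) * (\<Sum>l=1..n. c l) \<le> h n * (\<Sum>l=1..n. c l)"
  proof (cases "n = 0")
    case False
    then show ?thesis using Suc.prems by (intro mult_right_mono) auto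
  qed simp
  also have "\<dots> \<le> (\<Sum>l=1..n. c l * h l)"
    using Suc.prems by (intro Suc.IH) auto
  finally show ?case by (simp add: algebra_simps)
qed simp

text \<open>By sparseness, signs \<open>- 1\<close> on \<open>B\<close> and \<open>1\<close> off it
  have nonnegative partial sums in order of rank. As \<open>g\<close> does not increase with the
  rank, summation by parts shows that \<open>B\<close> carries no more of the sum than its
  complement.\<close>

lemma sum_le_twice_sum_sparse_complement:
  fixes g :: "'i \<Rightarrow> real" and r :: "'i \<Rightarrow> nat"
  assumes r: "bij_betw r I {1..n}" and B: "B \<subseteq> I"
    and g: "\<And>i. i \<in> I \<Longrightarrow> g i \<ge> 0"
    and mono: "\<And>i i'. i \<in> I \<Longrightarrow> i' \<in> I \<Longrightarrow> r i \<le> r i' \<Longrightarrow> g i' \<le> g i"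
    and sparse: "\<And>k. 1 \<le> k \<Longrightarrow> k \<le> n \<Longrightarrow> 2 * card {i \<in> B. r i \<le> k} \<le> k"
  shows "(\<Sum>i\<in>I. g i) \<le> 2 * (\<Sum>i\<in>I - B. g i)"
proof -
  define e where "e = inv_into I r"
  have e: "bij_betw e {1..n} I" unfolding e_def by (rule bij_betw_inv_into[OF r])
  have re: "r (e l) = l" if "l \<in> {1..n}" for l
    unfolding e_def using that r by (meson bij_betw_inv_into_right)
  have eI: "e l \<in> I" if "l \<in> {1..n}" for l using e that by (meson bij_betwE)
  have finI: "finite I" using r bij_betw_finite by blast
  define c :: "nat \<Rightarrow> real" where "c l = (if e l \<in> B then - 1 else 1)" for l
  have "0 \<le> (\<Sum>l=1..k. c l)" if k: "k \<in> {1..n}" for k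
  proof -
    have "bij_betw e {l \<in> {1..k}. e l \<in> B} {i \<in> B. r i \<le> k}"
    proof (rule bij_betw_imageI)
      show "inj_on e {l \<in> {1..k}. e l \<in> B}"
        using e k by (auto simp: bij_betw_def intro: inj_on_subset)
      show "e ` {l \<in> {1..k}. e l \<in> B} = {i \<in> B. r i \<le> k}"
      proof (intro equalityI subsetI)
        fix i assume i: "i \<in> {i \<in> B. r i \<le> k}"
        then have "i \<in> I" using B by auto
        then have "r i \<in> {1..n}" "e (r i) = i"
          using r by (auto simp: e_def bij_betw_def)
        then show "i \<in> e ` {l \<in> {1..k}. e l \<in> B}" using i by (intro image_eqI[of _ _ "r i"]) auto
      qed (use re k in auto)
    qed
    then have "card {l \<in> {1..k}. e l \<in> B} = card {i \<in> B. r i \<le> k}"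
      by (rule bij_betw_same_card)
    moreover have "(\<Sum>l=1..k. c l) = (\<Sum>l=1..k. 1 - 2 * of_bool (e l \<in> B))"
      by (intro sum.cong) (auto simp: c_def)
    moreover have "\<dots> = real k - 2 * real (card {l \<in> {1..k}. e l \<in> B})"
      by (simp add: sum_subtractf sum_distrib_left [symmetric] Int_def)
    ultimately show ?thesis using sparse[of k] k by simp
  qed
  then have "(\<Sum>l=1..n. c l * g (e l)) \<ge> g (e n) * (\<Sum>l=1..n. c l)"
    using g mono re eI by (intro sum_mult_antimono_ge) auto
  moreover have "g (e n) * (\<Sum>l=1..n. c l) \<ge> 0"
  proof (cases "n = 0")
    case False
    then show ?thesis using \<open>\<And>k. k \<in> {1..n} \<Longrightarrow> _ \<le> _\<close> g eI[of n] by simp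
  qed simp
  moreover have "(\<Sum>l=1..n. c l * g (e l)) = (\<Sum>i\<in>I. (if i \<in> B then - 1 else 1) * g i)"
    using sum.reindex_bij_betw[OF e, of "\<lambda>i. (if i \<in> B then - 1 else 1) * g i"] by (simp add: c_def)
  moreover have "(\<Sum>i\<in>I. (if i \<in> B then - 1 else 1) * g i) = (\<Sum>i\<in>I - B. g i) - (\<Sum>i\<in>B. g i)"
    using finI B by (subst sum.subset_diff[OF B finI]) (simp add: sum_negf)
  moreover have "(\<Sum>i\<in>I. g i) = (\<Sum>i\<in>I - B. g i) + (\<Sum>i\<in>B. g i)"
    by (rule sum.subset_diff[OF B finI])
  ultimately show ?thesis by simp
qed

section \<open>Fibre weights and heavy entries\<close>

text \<open>The fibre over \<open>y\<close> consists of the entries \<open>y(j := t)\<close>, and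
  \<open>r\<close> ranks the entries; the estimates below use
  \<open>s = - 1 / real m\<close>.\<close>

definition fibre_weight :: "'b set \<Rightarrow> (('a \<Rightarrow> 'b) \<Rightarrow> nat) \<Rightarrow> real \<Rightarrow> 'a \<Rightarrow> ('a \<Rightarrow> 'b) \<Rightarrow> nat \<Rightarrow> real" where
  "fibre_weight X r s j y k = (\<Sum>t\<in>{t \<in> X. r (y(j := t)) \<le> k}. real (r (y(j := t))) powr s)"

lemma fibre_weight_nonneg: "fibre_weight X r s j y k \<ge> 0"
  by (auto simp: fibre_weight_def intro: sum_nonneg)

text \<open>The fibres in direction \<open>j\<close> partition the grid and ranks are distinct, so
  the total is at most the sum of \<open>l powr (- 1 / m)\<close> over all \<open>l\<close> up to
  \<open>k\<close>.\<close>

lemma sum_fibre_weight_le: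
  assumes J: "finite J" "j \<in> J" and X: "finite X" and m: "m \<ge> 2"
    and r: "inj_on r (J \<rightarrow>\<^sub>E X)" "\<And>i. i \<in> J \<rightarrow>\<^sub>E X \<Longrightarrow> r i \<ge> 1"
  shows "(\<Sum>y\<in>(J - {j}) \<rightarrow>\<^sub>E X. fibre_weight X r (- 1 / real m) j y k)
    \<le> 2 * real k powr ((real m - 1) / m)"
proof -
  define I where "I = {i \<in> J \<rightarrow>\<^sub>E X. r i \<le> k}"
  have fin: "finite (J \<rightarrow>\<^sub>E X)" using J X by (simp add: finite_PiE)
  have "(\<Sum>y\<in>(J - {j}) \<rightarrow>\<^sub>E X. fibre_weight X r (- 1 / real m) j y k)
      = (\<Sum>i\<in>J \<rightarrow>\<^sub>E X. if r i \<le> k then real (r i) powr (- 1 / real m) else 0)"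
    using X by (subst sum_PiE_split[OF J(1) X J(2)]) (simp add: fibre_weight_def sum.inter_filter cong: if_cong)
  also have "\<dots> = (\<Sum>i\<in>I. real (r i) powr (- 1 / real m))"
    using fin by (simp add: I_def sum.inter_filter cong: if_cong)
  also have "\<dots> = (\<Sum>l\<in>r ` I. real l powr (- 1 / real m))"
    using r(1) by (subst sum.reindex) (auto simp: I_def intro: inj_on_subset)
  also have "\<dots> \<le> (\<Sum>l=1..k. real l powr (- 1 / real m))"
    using r(2) by (intro sum_mono2) (auto simp: I_def)
  also have "\<dots> \<le> 2 * real k powr ((real m - 1) / m)" by (rule sum_powr_minus_le[OF m])
  finally show ?thesis .
qed

text \<open>By Markov's inequality at most \<open>k powr ((m - 1) / m) / 2\<close> fibres in each
  direction have weight above 4, which is twice the constant of \<open>sum_fibre_weight_le\<close>.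
  The counted entries lie on such fibres in every direction, so Loomis--Whitney bounds their
  number.\<close>

lemma card_heavy_le:
  assumes J: "finite J" "card J = m" "m \<ge> 2" and X: "finite X"
    and r: "inj_on r (J \<rightarrow>\<^sub>E X)" "\<And>i. i \<in> J \<rightarrow>\<^sub>E X \<Longrightarrow> r i \<ge> 1"
  shows "2 * card {i \<in> J \<rightarrow>\<^sub>E X. r i \<le> k \<and>
    (\<forall>j\<in>J. fibre_weight X r (- 1 / real m) j (restrict i (J - {j})) (r i) > 4)} \<le> k"
proof -
  define W where "W = fibre_weight X r (- 1 / real m)"
  define B where "B = {i \<in> J \<rightarrow>\<^sub>E X. r i \<le> k \<and> (\<forall>j\<in>J. W j (restrict i (J - {j})) (r i) > 4)}"
  \<comment> \<open>The level is \<open>k\<close> rather than the rank of an entry, so that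
    \<open>f j\<close> depends on the fibre alone; \<open>W_mono\<close> allows this.\<close>
  define f :: "'a \<Rightarrow> ('a \<Rightarrow> 'b) \<Rightarrow> real" where "f j y = of_bool (W j y k > 4)" for j y
  have fin: "finite (J \<rightarrow>\<^sub>E X)" using J X by (simp add: finite_PiE)
  have W_mono: "W j y k' \<le> W j y k" if "k' \<le> k" for j y k'
    unfolding W_def fibre_weight_def using that X by (intro sum_mono2) auto
  have f_sum: "(\<Sum>y\<in>(J - {j}) \<rightarrow>\<^sub>E X. f j y) \<le> real k powr ((real m - 1) / m) / 2" if "j \<in> J" for j
  proof -
    have "(\<Sum>y\<in>(J - {j}) \<rightarrow>\<^sub>E X. f j y) \<le> (\<Sum>y\<in>(J - {j}) \<rightarrow>\<^sub>E X. W j y k / 4)"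
      using fibre_weight_nonneg by (intro sum_mono) (auto simp: f_def W_def)
    then show ?thesis
      using sum_fibre_weight_le[OF J(1) that X J(3) r, of k]
      by (simp add: W_def sum_divide_distrib [symmetric])
  qed
  have "real (card B) = (\<Sum>i\<in>B. 1)" by simp
  also have "\<dots> \<le> (\<Sum>i\<in>B. (\<Prod>j\<in>J. f j (restrict i (J - {j}))) powr (1 / (real m - 1)))"
  proof (rule sum_mono)
    fix i assume i: "i \<in> B"
    then have "f j (restrict i (J - {j})) = 1" if "j \<in> J" for j
      using W_mono[of "r i" j "restrict i (J - {j})"] that by (force simp: B_def f_def)
    then show "1 \<le> (\<Prod>j\<in>J. f j (restrict i (J - {j}))) powr (1 / (real m - 1))" by simp
  qed
  also have "\<dots> \<le> (\<Sum>i\<in>J \<rightarrow>\<^sub>E X. (\<Prod>j\<in>J. f j (restrict i (J - {j}))) powr (1 / (real m - 1)))"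
    using fin by (intro sum_mono2) (auto simp: B_def)
  also have "\<dots> \<le> (\<Prod>j\<in>J. \<Sum>y\<in>(J - {j}) \<rightarrow>\<^sub>E X. f j y) powr (1 / (real m - 1))"
    by (intro Loomis_Whitney J X) (simp add: f_def)
  also have "\<dots> \<le> (\<Prod>j\<in>J. real k powr ((real m - 1) / m) / 2) powr (1 / (real m - 1))"
    using f_sum J by (intro powr_mono2 prod_mono prod_nonneg conjI sum_nonneg) (auto simp: f_def)
  also have "\<dots> \<le> real k / 2"
  proof (cases "k = 0")
    case False
    \<comment> \<open>Loomis--Whitney raises the halved bound to the power
      \<open>p = m / (m - 1)\<close>, and \<open>p \<ge> 1\<close> preserves the gain of a
      half.\<close>
    define p where "p = real m * (1 / (real m - 1))"
    have p: "p \<ge> 1" "(real m - 1) / m * p = 1" using J by (auto simp: p_def field_simps)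
    have "(\<Prod>j\<in>J. real k powr ((real m - 1) / m) / 2) powr (1 / (real m - 1))
        = (real k powr ((real m - 1) / m) / 2) powr p"
      using J False unfolding p_def by (simp add: powr_realpow [symmetric] powr_powr)
    also have "\<dots> = real k / 2 powr p"
      unfolding powr_divide powr_powr p(2) by simp
    also have "\<dots> \<le> real k / 2"
      using powr_mono[OF p(1), of 2] by (intro divide_left_mono) auto
    finally show ?thesis .
  qed (use J in simp)
  finally show ?thesis unfolding B_def W_def by linarith
qed

text \<open>The 8 is a factor 2 for dropping the entries light in no direction times 4 for the
  estimate on a fibre. An entry light in several directions is counted in each, which the sum over
  \<open>j\<close> permits.\<close>

theorem Fournier_inequality:
  fixes b :: "('a \<Rightarrow> 'b) \<Rightarrow> real"
  assumes J: "finite J" "card J = m" "m \<ge> 2" and X: "finite X"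
    and r: "bij_betw r (J \<rightarrow>\<^sub>E X) {1..n}"
    and b: "\<And>i. b i \<ge> 0"
    and mono: "\<And>i i'. i \<in> J \<rightarrow>\<^sub>E X \<Longrightarrow> i' \<in> J \<rightarrow>\<^sub>E X \<Longrightarrow> r i \<le> r i' \<Longrightarrow> b i' \<le> b i"
  shows "(\<Sum>i\<in>J \<rightarrow>\<^sub>E X. b i powr (2 * (real m - 1) / m) * real (r i) powr (- 1 / (real m)\<^sup>2))
    \<le> 8 * (\<Sum>j\<in>J. \<Sum>y\<in>(J - {j}) \<rightarrow>\<^sub>E X. (\<Sum>t\<in>X. (b (y(j := t)))\<^sup>2) powr ((real m - 1) / m))"
proof -
  define W where "W = fibre_weight X r (- 1 / real m)"
  define light where "light j i \<longleftrightarrow> W j (restrict i (J - {j})) (r i) \<le> 4" for j i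
  define B where "B = {i \<in> J \<rightarrow>\<^sub>E X. \<forall>j\<in>J. \<not> light j i}"
  define g where "g i = b i powr (2 * (real m - 1) / m) * real (r i) powr (- 1 / (real m)\<^sup>2)" for i
  have fin: "finite (J \<rightarrow>\<^sub>E X)" using J X by (simp add: finite_PiE)
  have inj: "inj_on r (J \<rightarrow>\<^sub>E X)" using r by (simp add: bij_betw_def)
  have r1: "r i \<ge> 1" if "i \<in> J \<rightarrow>\<^sub>E X" for i using bij_betwE[OF r] that by auto
  have g0: "g i \<ge> 0" for i by (simp add: g_def)
  \<comment> \<open>This is the shape for Hoelder's inequality on a fibre with exponents
    \<open>m\<close> and \<open>m / (m - 1)\<close>.\<close>
  have g_eq: "g i = (real (r i) powr (- 1 / real m)) powr (1 / m) * ((b i)\<^sup>2) powr ((real m - 1) / m)" for i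
  proof -
    have "((b i)\<^sup>2) powr ((real m - 1) / m) = b i powr (2 * (real m - 1) / m)"
    proof (cases "b i = 0")
      case False
      then have "(b i)\<^sup>2 = b i powr 2" using b[of i] by simp
      then show ?thesis by (simp only: powr_powr times_divide_eq_right)
    qed simp
    moreover have "- 1 / real m * (1 / m) = - 1 / (real m)\<^sup>2" by (simp add: power2_eq_square)
    ultimately show ?thesis unfolding g_def powr_powr by simp
  qed
  have "(\<Sum>i\<in>J \<rightarrow>\<^sub>E X. g i) \<le> 2 * (\<Sum>i\<in>(J \<rightarrow>\<^sub>E X) - B. g i)"
  proof (rule sum_le_twice_sum_sparse_complement[OF r _ g0])
    show "B \<subseteq> J \<rightarrow>\<^sub>E X" by (auto simp: B_def)
    show "2 * card {i \<in> B. r i \<le> k} \<le> k" for k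
    proof -
      have "{i \<in> B. r i \<le> k} = {i \<in> J \<rightarrow>\<^sub>E X. r i \<le> k \<and> (\<forall>j\<in>J. W j (restrict i (J - {j})) (r i) > 4)}"
        by (auto simp: B_def light_def not_le)
      then show ?thesis using card_heavy_le[OF J X inj r1, of k] by (simp add: W_def)
    qed
    show "g i' \<le> g i" if "i \<in> J \<rightarrow>\<^sub>E X" "i' \<in> J \<rightarrow>\<^sub>E X" "r i \<le> r i'" for i i'
      using mono[OF that] that(3) r1[OF that(1)] b J unfolding g_def
      by (intro mult_mono powr_mono2 powr_mono2') auto
  qed
  also have "(\<Sum>i\<in>(J \<rightarrow>\<^sub>E X) - B. g i) \<le> (\<Sum>i\<in>(J \<rightarrow>\<^sub>E X) - B. \<Sum>j\<in>J. of_bool (light j i) * g i)"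
  proof (rule sum_mono)
    fix i assume "i \<in> (J \<rightarrow>\<^sub>E X) - B"
    then obtain j where "j \<in> J" "light j i" by (auto simp: B_def)
    then show "g i \<le> (\<Sum>j\<in>J. of_bool (light j i) * g i)"
      using member_le_sum[of j J "\<lambda>j. of_bool (light j i) * g i"] J g0 by simp
  qed
  also have "\<dots> \<le> (\<Sum>i\<in>J \<rightarrow>\<^sub>E X. \<Sum>j\<in>J. of_bool (light j i) * g i)"
    using fin g0 by (intro sum_mono2 sum_nonneg) auto
  also have "\<dots> = (\<Sum>j\<in>J. \<Sum>i\<in>J \<rightarrow>\<^sub>E X. of_bool (light j i) * g i)" by (rule sum.swap)
  also have "\<dots> \<le> (\<Sum>j\<in>J. 4 * (\<Sum>y\<in>(J - {j}) \<rightarrow>\<^sub>E X. (\<Sum>t\<in>X. (b (y(j := t)))\<^sup>2) powr ((real m - 1) / m)))"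
  proof (rule sum_mono)
    fix j assume j: "j \<in> J"
    have "(\<Sum>i\<in>J \<rightarrow>\<^sub>E X. of_bool (light j i) * g i)
        = (\<Sum>y\<in>(J - {j}) \<rightarrow>\<^sub>E X. \<Sum>t\<in>X. of_bool (light j (y(j := t))) * g (y(j := t)))"
      by (rule sum_PiE_split[OF J(1) X j])
    also have "\<dots> \<le> (\<Sum>y\<in>(J - {j}) \<rightarrow>\<^sub>E X. 4 * (\<Sum>t\<in>X. (b (y(j := t)))\<^sup>2) powr ((real m - 1) / m))"
    proof (rule sum_mono)
      fix y assume y: "y \<in> (J - {j}) \<rightarrow>\<^sub>E X"
      define L where "L = {t \<in> X. light j (y(j := t))}"
      define w where "w t = real (r (y(j := t))) powr (- 1 / real m)" for t
      have light_y: "light j (y(j := t)) \<longleftrightarrow> W j y (r (y(j := t))) \<le> 4" for t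
        using y by (simp add: light_def)
      have finL: "finite L" using X by (simp add: L_def)
      \<comment> \<open>The fibre weight at the light entry of largest rank counts all light entries
        of the fibre, and lightness bounds it by 4.\<close>
      have L4: "(\<Sum>t\<in>L. w t) \<le> 4"
      proof (cases "L = {}")
        case False
        define R where "R = (\<lambda>t. r (y(j := t))) ` L"
        have "Max R \<in> R" using False finL by (intro Max_in) (auto simp: R_def)
        then obtain t where "t \<in> L" "Max R = r (y(j := t))" by (auto simp: R_def)
        moreover have "r (y(j := t')) \<le> Max R" if "t' \<in> L" for t'
          using that finL by (intro Max_ge) (auto simp: R_def)
        ultimately have t: "t \<in> L" "\<And>t'. t' \<in> L \<Longrightarrow> r (y(j := t')) \<le> r (y(j := t))"
          by auto
        have "(\<Sum>t\<in>L. w t) \<le> W j y (r (y(j := t)))"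
          unfolding W_def fibre_weight_def w_def using t X by (intro sum_mono2) (auto simp: L_def)
        also have "\<dots> \<le> 4" using t(1) light_y by (simp add: L_def)
        finally show ?thesis .
      qed simp
      have "(\<Sum>t\<in>X. of_bool (light j (y(j := t))) * g (y(j := t))) = (\<Sum>t\<in>L. g (y(j := t)))"
        using X by (simp add: L_def sum.inter_filter of_bool_def if_distrib if_distribR cong: if_cong)
      also have "\<dots> \<le> (\<Sum>t\<in>L. w t) powr (1 / m) * (\<Sum>t\<in>L. (b (y(j := t)))\<^sup>2) powr ((real m - 1) / m)"
        unfolding g_eq w_def using J by (intro Hoelder_sum_two) auto
      also have "\<dots> \<le> 4 * (\<Sum>t\<in>X. (b (y(j := t)))\<^sup>2) powr ((real m - 1) / m)"
      proof (intro mult_mono powr_mono2)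
        have "(\<Sum>t\<in>L. w t) powr (1 / m) \<le> 4 powr (1 / m)"
          using L4 by (intro powr_mono2 sum_nonneg) (auto simp: w_def)
        also have "\<dots> \<le> 4 powr 1" using J by (intro powr_mono) auto
        finally show "(\<Sum>t\<in>L. w t) powr (1 / m) \<le> 4" by simp
        show "(\<Sum>t\<in>L. (b (y(j := t)))\<^sup>2) \<le> (\<Sum>t\<in>X. (b (y(j := t)))\<^sup>2)"
          using X by (intro sum_mono2) (auto simp: L_def)
      qed (use J in \<open>auto intro: sum_nonneg\<close>)
      finally show "(\<Sum>t\<in>X. of_bool (light j (y(j := t))) * g (y(j := t)))
          \<le> 4 * (\<Sum>t\<in>X. (b (y(j := t)))\<^sup>2) powr ((real m - 1) / m)" .
    qed
    finally show "(\<Sum>i\<in>J \<rightarrow>\<^sub>E X. of_bool (light j i) * g i)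
        \<le> 4 * (\<Sum>y\<in>(J - {j}) \<rightarrow>\<^sub>E X. (\<Sum>t\<in>X. (b (y(j := t)))\<^sup>2) powr ((real m - 1) / m))"
      by (simp add: sum_distrib_left)
  qed
  finally show ?thesis by (simp add: g_def sum_distrib_left [symmetric])
qed

section \<open>The Lorentz norm\<close>

text \<open>\<open>decr_rearr\<close> records only values; sorting the indices by modulus attaches
  an index to each position, ties included. Positions start at 1 here and at 0 in the list.\<close>

lemma decr_rearr_enumeration:
  assumes "finite I"
  obtains e where "bij_betw e {1..card I} I"
    and "\<And>k. k \<in> {1..card I} \<Longrightarrow> decr_rearr I x ! (k - 1) = cmod (x (e k))"
    and "\<And>k l. 1 \<le> k \<Longrightarrow> k \<le> l \<Longrightarrow> l \<le> card I \<Longrightarrow> cmod (x (e l)) \<le> cmod (x (e k))"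
proof -
  define f where "f i = cmod (x i)" for i
  obtain xs where xs: "set xs = I" "distinct xs" using finite_distinct_list[OF assms] by blast
  define zs where "zs = rev (sort_key f xs)"
  have zs: "set zs = I" "distinct zs" "length zs = card I"
    using xs distinct_card[of xs] by (auto simp: zs_def)
  have "mset_set I = mset xs" using mset_set_set[OF xs(2)] xs(1) by simp
  then have "image_mset f (mset_set I) = mset (map f (sort_key f xs))" by simp
  then have "sorted_list_of_multiset (image_mset f (mset_set I)) = sort (map f (sort_key f xs))"
    by (simp only: sorted_list_of_multiset_mset)
  also have "\<dots> = map f (sort_key f xs)" by (simp add: sorted_sort_id)
  finally have dec: "decr_rearr I x = map f zs"
    unfolding decr_rearr_def f_def [symmetric] by (simp add: zs_def rev_map)
  have sorted: "sorted (rev (map f zs))" by (simp add: zs_def rev_map)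
  have nth: "decr_rearr I x ! (k - 1) = f (zs ! (k - 1))" if "k \<in> {1..card I}" for k
    using that zs(3) by (auto simp: dec intro!: nth_map)
  show ?thesis
  proof
    have "bij_betw (\<lambda>k. k - 1) {1..card I} {..<length zs}"
      by (rule bij_betw_byWitness[of _ Suc]) (use zs in auto)
    then have "bij_betw ((!) zs \<circ> (\<lambda>k. k - 1)) {1..card I} I"
      using bij_betw_nth[OF zs(2) refl refl] zs(1) by (metis bij_betw_trans)
    then show "bij_betw (\<lambda>k. zs ! (k - 1)) {1..card I} I" by (simp add: o_def)
    show "cmod (x (zs ! (l - 1))) \<le> cmod (x (zs ! (k - 1)))" if "1 \<le> k" "k \<le> l" "l \<le> card I" for k l
      using sorted_rev_nth_mono[OF sorted, of "k - 1" "l - 1"] that zs(3) by (simp add: f_def)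
  qed (use nth in \<open>simp add: f_def\<close>)
qed

text \<open>As \<open>s - 1 \<le> 0\<close>, \<open>(k - 1) powr s\<close> is at least
  \<open>(k - 1) * k powr (s - 1)\<close>. This bounds the weights in the Lorentz norm.\<close>

lemma powr_diff_le:
  fixes s :: real
  assumes s: "s \<le> 1" and k: "k \<ge> 1"
  shows "real k powr s - real (k - 1) powr s \<le> real k powr (s - 1)"
proof (cases "k = 1")
  case False
  then have k2: "k \<ge> 2" using k by simp
  have split: "x powr s = x * x powr (s - 1)" if "x > 0" for x :: real
    using that powr_mult_base[of x "s - 1"] by simp
  have "real k powr (s - 1) \<le> real (k - 1) powr (s - 1)"
    using s k2 by (intro powr_mono2') auto
  then have "real (k - 1) * real k powr (s - 1) \<le> real (k - 1) powr s"
    using k2 by (subst split) (auto intro: mult_left_mono)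
  moreover have "real k powr s = real (k - 1) * real k powr (s - 1) + real k powr (s - 1)"
    using k2 by (subst split) (auto simp: of_nat_diff algebra_simps)
  ultimately show ?thesis by simp
qed simp

text \<open>Fournier's inequality and the mixed bounds give
  \<open>8 * m * (m\<^sup>2 * D) powr q\<close> for the \<open>q\<close>-th power. Since
  \<open>q \<ge> 1\<close>, the root is at most \<open>8 * m ^ 3 * D\<close>, and
  \<open>8 \<le> m ^ 3\<close>.\<close>

lemma lorentz_norm_le:
  assumes m: "m \<ge> 2" and I: "bij_betw \<phi> (J \<rightarrow>\<^sub>E X) I" and J: "finite J" "card J = m" and X: "finite X"
    and a: "form_bounded J X (a \<circ> \<phi>) D" and D: "D > 0"
  shows "lorentz_norm (2 * real m / (real m + 1)) (2 * (real m - 1) / real m) I a \<le> real m powr 6 * D"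
proof -
  define p where "p = 2 * real m / (real m + 1)"
  define q where "q = 2 * (real m - 1) / real m"
  have q: "q \<ge> 1" using m by (simp add: q_def field_simps)
  have "(real m - 1) * (real m + 1) = (real m)\<^sup>2 - 1" by (simp add: power2_eq_square algebra_simps)
  moreover have "2 * y / real m / (2 * real m / z) = y * z / (real m)\<^sup>2" for y z
    by (simp add: power2_eq_square)
  then have "q / p = (real m - 1) * (real m + 1) / (real m)\<^sup>2" by (simp only: p_def q_def)
  ultimately have "q / p = ((real m)\<^sup>2 - 1) / (real m)\<^sup>2" by (simp only:)
  \<comment> \<open>With this ratio the Lorentz weight at rank \<open>k\<close> is at most
    \<open>k powr (- 1 / m\<^sup>2)\<close>, the weight in Fournier's inequality.\<close>
  then have qp: "q / p = 1 - 1 / (real m)\<^sup>2" using m by (simp add: diff_divide_distrib)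
  have "finite I" using bij_betw_finite[OF I] J(1) X by (simp add: finite_PiE)
  then obtain e where e: "bij_betw e {1..card I} I"
    and e_nth: "\<And>k. k \<in> {1..card I} \<Longrightarrow> decr_rearr I a ! (k - 1) = cmod (a (e k))"
    and e_mono: "\<And>k l. 1 \<le> k \<Longrightarrow> k \<le> l \<Longrightarrow> l \<le> card I \<Longrightarrow> cmod (a (e l)) \<le> cmod (a (e k))"
    using decr_rearr_enumeration[of I a] by blast
  \<comment> \<open>\<open>r i\<close> is the position of the entry at \<open>i\<close> in the
    decreasing order.\<close>
  define r where "r = inv_into {1..card I} e \<circ> \<phi>"
  have r: "bij_betw r (J \<rightarrow>\<^sub>E X) {1..card I}"
    unfolding r_def by (rule bij_betw_trans[OF I bij_betw_inv_into[OF e]])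
  have er: "e (r i) = \<phi> i" if "i \<in> J \<rightarrow>\<^sub>E X" for i
    using that I e unfolding r_def o_def by (metis bij_betwE bij_betw_inv_into_right)
  have r_in: "r i \<in> {1..card I}" if "i \<in> J \<rightarrow>\<^sub>E X" for i using bij_betwE[OF r] that by blast
  have mono: "cmod (a (\<phi> i')) \<le> cmod (a (\<phi> i))"
    if "i \<in> J \<rightarrow>\<^sub>E X" "i' \<in> J \<rightarrow>\<^sub>E X" "r i \<le> r i'" for i i'
    using e_mono[of "r i" "r i'"] that r_in er by simp
  have "(\<Sum>k=1..card I. (decr_rearr I a ! (k - 1)) powr q * (real k powr (q / p) - real (k - 1) powr (q / p)))
      \<le> (\<Sum>k=1..card I. cmod (a (e k)) powr q * real k powr (- 1 / (real m)\<^sup>2))"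
  proof (rule sum_mono)
    fix k assume k: "k \<in> {1..card I}"
    have "real k powr (q / p) - real (k - 1) powr (q / p) \<le> real k powr (- 1 / (real m)\<^sup>2)"
      using powr_diff_le[of "q / p" k] k unfolding qp by simp
    then show "(decr_rearr I a ! (k - 1)) powr q * (real k powr (q / p) - real (k - 1) powr (q / p))
        \<le> cmod (a (e k)) powr q * real k powr (- 1 / (real m)\<^sup>2)"
      unfolding e_nth[OF k] by (intro mult_left_mono) auto
  qed
  also have "\<dots> = (\<Sum>i\<in>J \<rightarrow>\<^sub>E X. cmod (a (\<phi> i)) powr q * real (r i) powr (- 1 / (real m)\<^sup>2))"
    by (subst sum.reindex_bij_betw[OF r, symmetric]) (use er in \<open>auto intro!: sum.cong\<close>)
  also have "\<dots> \<le> 8 * (\<Sum>j\<in>J. \<Sum>y\<in>(J - {j}) \<rightarrow>\<^sub>E X. (\<Sum>t\<in>X. (cmod (a (\<phi> (y(j := t)))))\<^sup>2) powr ((real m - 1) / m))"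
    unfolding q_def
    by (rule Fournier_inequality[OF J m X r, where b = "\<lambda>i. cmod (a (\<phi> i))"]) (use mono in auto)
  also have "\<dots> \<le> 8 * (\<Sum>j\<in>J. (real m ^ 2 * D) powr q)"
    using Bohnenblust_Hille_mixed[OF m J X a D] unfolding q_def o_def
    by (intro mult_left_mono sum_mono) auto
  also have "\<dots> = 8 * real m * (real m ^ 2 * D) powr q" using J by simp
  finally have "lorentz_norm p q I a \<le> (8 * real m * (real m ^ 2 * D) powr q) powr (1 / q)"
    unfolding lorentz_norm_def
  proof (rule powr_mono2[rotated 2])
    show "0 \<le> (\<Sum>k=1..card I. (decr_rearr I a ! (k - 1)) powr q * (real k powr (q / p) - real (k - 1) powr (q / p)))"
      using m by (intro sum_nonneg mult_nonneg_nonneg) (auto simp: qp intro!: powr_mono2)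
  qed (use q in simp)
  also have "\<dots> = (8 * real m) powr (1 / q) * (real m ^ 2 * D)"
    using q D m by (simp add: powr_mult powr_powr)
  also have "\<dots> \<le> (8 * real m) powr 1 * (real m ^ 2 * D)"
    using q D m by (intro mult_right_mono powr_mono) auto
  also have "\<dots> = 8 * real m ^ 3 * D" using m by (simp add: power2_eq_square power3_eq_cube)
  also have "\<dots> \<le> real m ^ 3 * real m ^ 3 * D"
    using D m power_mono[of 2 "real m" 3] by (intro mult_right_mono) auto
  also have "\<dots> = real m powr 6 * D" using m by (simp flip: power_add)
  finally show ?thesis by (simp add: p_def q_def)
qed

section \<open>Transfer from functions on \<open>{..<m}\<close> to index lists\<close>

lemma bij_betw_multi_idx: "bij_betw (\<lambda>i. map i [0..<m]) ({..<m} \<rightarrow>\<^sub>E {1..n}) (multi_idx m n)"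
proof (rule bij_betwI)
  show "(\<lambda>i. map i [0..<m]) \<in> ({..<m} \<rightarrow>\<^sub>E {1..n}) \<rightarrow> multi_idx m n"
  proof
    fix i :: "nat \<Rightarrow> nat" assume "i \<in> {..<m} \<rightarrow>\<^sub>E {1..n}"
    then have "i ` {..<m} \<subseteq> {1..n}" by blast
    then show "map i [0..<m] \<in> multi_idx m n"
      by (simp add: multi_idx_def lessThan_atLeast0)
  qed
  show "(\<lambda>l. restrict ((!) l) {..<m}) \<in> multi_idx m n \<rightarrow> ({..<m} \<rightarrow>\<^sub>E {1..n})"
  proof (intro funcsetI PiE_I)
    fix l k assume "l \<in> multi_idx m n" and k: "k \<in> {..<m}"
    then have "k < length l" "set l \<subseteq> {1..n}" by (simp_all add: multi_idx_def)
    then have "l ! k \<in> {1..n}" using nth_mem by blast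
    then show "restrict ((!) l) {..<m} k \<in> {1..n}" using k by simp
  qed simp
  show "restrict ((!) (map i [0..<m])) {..<m} = i" if "i \<in> {..<m} \<rightarrow>\<^sub>E {1..n}" for i
  proof (rule PiE_ext[OF _ that])
    show "restrict ((!) (map i [0..<m])) {..<m} \<in> {..<m} \<rightarrow>\<^sub>E {1..n}"
      using PiE_mem[OF that] by (simp add: restrict_PiE_iff)
  qed simp
  show "map (restrict ((!) l) {..<m}) [0..<m] = l" if "l \<in> multi_idx m n" for l
    using that by (intro nth_equalityI) (simp_all add: multi_idx_def)
qed

text \<open>A real \<open>Sup\<close> is an upper bound only for a set bounded above; the sum of all
  \<open>cmod (a i)\<close> provides such a bound.\<close>

lemma mult_sup_norm_upper:
  assumes x: "\<forall>k<m. \<forall>j\<in>{1..n}. cmod (x k j) \<le> 1"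
  shows "cmod (\<Sum>i\<in>multi_idx m n. a i * (\<Prod>k<m. x k (i ! k))) \<le> mult_sup_norm m n a"
  unfolding mult_sup_norm_def
proof (rule cSup_upper)
  show "bdd_above {cmod (\<Sum>i\<in>multi_idx m n. a i * (\<Prod>k<m. x k (i ! k))) | x :: nat \<Rightarrow> nat \<Rightarrow> complex.
            \<forall>k<m. \<forall>j\<in>{1..n}. cmod (x k j) \<le> 1}"
  proof (rule bdd_aboveI, clarify)
    fix x :: "nat \<Rightarrow> nat \<Rightarrow> complex" assume x: "\<forall>k<m. \<forall>j\<in>{1..n}. cmod (x k j) \<le> 1"
    show "cmod (\<Sum>i\<in>multi_idx m n. a i * (\<Prod>k<m. x k (i ! k))) \<le> (\<Sum>i\<in>multi_idx m n. cmod (a i))"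
    proof (rule sum_norm_le)
      fix i assume "i \<in> multi_idx m n"
      then have "i ! k \<in> {1..n}" if "k < m" for k
        using that nth_mem[of k i] unfolding multi_idx_def by blast
      then have "(\<Prod>k<m. cmod (x k (i ! k))) \<le> 1"
        using x by (intro prod_le_1) auto
      then show "cmod (a i * (\<Prod>k<m. x k (i ! k))) \<le> cmod (a i)"
        by (simp add: norm_mult prod_norm [symmetric] mult_left_le)
    qed
  qed
qed (use x in blast)

lemma form_bounded_mult_sup_norm:
  assumes "mult_sup_norm m n a \<le> D"
  shows "form_bounded {..<m} {1..n} (a \<circ> (\<lambda>i. map i [0..<m])) D"
  unfolding form_bounded_def
proof (intro allI impI)
  fix x :: "nat \<Rightarrow> nat \<Rightarrow> complex" assume x: "\<forall>k\<in>{..<m}. \<forall>t\<in>{1..n}. cmod (x k t) \<le> 1"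
  have "multilinear_form {..<m} {1..n} (a \<circ> (\<lambda>i. map i [0..<m])) x
      = (\<Sum>i\<in>multi_idx m n. a i * (\<Prod>k<m. x k (i ! k)))"
    unfolding multilinear_form_def
    by (subst sum.reindex_bij_betw[OF bij_betw_multi_idx, symmetric]) (auto intro!: sum.cong prod.cong)
  then show "cmod (multilinear_form {..<m} {1..n} (a \<circ> (\<lambda>i. map i [0..<m])) x) \<le> D"
    using mult_sup_norm_upper[of m n x a] x assms by auto
qed

theorem theorem4p5:
  shows "\<exists>\<delta>::real. \<delta> > 0 \<and> (\<forall>m::nat. m \<ge> 2 \<longrightarrow>
    BH_mult_lorentz (2 * real m / (real m + 1)) (2 * (real m - 1) / real m) m
      \<le> ereal (real m powr \<delta>))"
proof (intro exI conjI allI impI)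
  show "(6::real) > 0" by simp
  fix m :: nat assume m: "m \<ge> 2"
  have pos: "real m powr 6 > 0" using m by simp
  have "lorentz_norm (2 * real m / (real m + 1)) (2 * (real m - 1) / real m) (multi_idx m n) a
      \<le> real m powr 6 * mult_sup_norm m n a" for n a
  \<comment> \<open>The preceding bounds require \<open>D > 0\<close>, while the sup norm may be 0;
    a surplus is added, scaled to contribute exactly \<epsilon>.\<close>
  proof (rule field_le_epsilon)
    fix \<epsilon> :: real assume \<epsilon>: "\<epsilon> > 0"
    define D where "D = mult_sup_norm m n a + \<epsilon> / real m powr 6"
    have "mult_sup_norm m n a \<ge> 0"
      using mult_sup_norm_upper[of m n "\<lambda>_ _. 0" a] by (simp add: order_trans[OF norm_ge_zero])
    then have D: "D > 0" "mult_sup_norm m n a \<le> D" using \<epsilon> pos by (simp_all add: D_def add_nonneg_pos)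
    have "lorentz_norm (2 * real m / (real m + 1)) (2 * (real m - 1) / real m) (multi_idx m n) a
        \<le> real m powr 6 * D"
      by (rule lorentz_norm_le[OF m bij_betw_multi_idx _ _ _ form_bounded_mult_sup_norm[OF D(2)] D(1)]) auto
    also have "\<dots> = real m powr 6 * mult_sup_norm m n a + \<epsilon>"
      using pos by (simp add: D_def distrib_left)
    finally show "lorentz_norm (2 * real m / (real m + 1)) (2 * (real m - 1) / real m) (multi_idx m n) a
      \<le> real m powr 6 * mult_sup_norm m n a + \<epsilon>" .
  qed
  moreover have "real m powr 6 \<ge> 1" using m by (intro ge_one_powr_ge_zero) auto
  ultimately show "BH_mult_lorentz (2 * real m / (real m + 1)) (2 * (real m - 1) / real m) m
      \<le> ereal (real m powr 6)"
    unfolding BH_mult_lorentz_def by (intro Inf_lower) auto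
qed

end
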